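(* Let $0<a<b<\infty$, let $p>1$ and $\alpha\in\left(\frac1p,1\right]$. Let $u\in AC[a,b]$ satisfy $u(a)=0$ and $\mathfrak{D}^{\alpha}_{a+}u\in L^p_{\frac1x}(a,b)$, where $\mathfrak{D}^{\alpha}_{a+}$ is the left Hadamard fractional derivative of order $\alpha$. Then $$\left\|\frac{u}{x}\right\|_{L^p(a,b)}\leq \frac{a^{-1}(b-a)^{\frac{1}{p}}\left|\log\frac{b}{a}\right|^{\alpha-\frac{1}{p}}}{\left(\frac{\alpha p}{p-1}-\frac{1}{p-1}\right)^{\frac{p-1}{p}}\Gamma(\alpha)} \left\|\mathfrak{D}^{\alpha}_{a+}u\right\|_{L^{p}_{\frac{1}{x}}(a,b)}.$$
   Context: $AC[a,b]$ is the space of (real- or complex-valued) absolutely continuous functions on $[a,b]$, $x$ denotes the variable in $(a,b)$, and $\Gamma$ is the Euler gamma function. For $0<\alpha<1$ and $f\in AC[a,b]$ the left Hadamard fractional derivative (of Caputo type) is $\mathfrak{D}_{a+}^{\alpha}f(t)=\frac{1}{\Gamma(1-\alpha)}\int_{a}^{t}\left(\log\frac{t}{s}\right)^{-\alpha}s f'(s)\,\frac{ds}{s}$ (for almost every $t\in(a,b]$), and for $\alpha=1$, $\mathfrak{D}_{a+}^1f(t)=t f'(t)$. For $p\ge1$, $\|v\|_{L^{p}_{\frac{1}{x}}(a,b)}=\left(\int_{a}^{b}|v(x)|^{p}\frac{dx}{x}\right)^{1/p}$, and $L^p_{\frac1x}(a,b)$ is the corresponding weighted Lebesgue space. *)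

theory Defs
  imports "HOL-Analysis.Analysis"
begin

(* AC[a,b]. A family of pairwise disjoint open subintervals (s,t) of [a,b] is represented by the
   finite set of its pairs of endpoints. *)
definition absolutely_continuous_on_Icc ::
    "real \<Rightarrow> real \<Rightarrow> (real \<Rightarrow> 'a::real_normed_vector) \<Rightarrow> bool" where
  "absolutely_continuous_on_Icc a b f \<longleftrightarrow>
     (\<forall>\<epsilon>>0. \<exists>\<delta>>0. \<forall>I :: (real \<times> real) set.
        finite I \<and>
        (\<forall>(s, t)\<in>I. a \<le> s \<and> s < t \<and> t \<le> b) \<and>
        pairwise (\<lambda>(s, t) (s', t'). {s<..<t} \<inter> {s'<..<t'} = {}) I \<and>
        (\<Sum>(s, t)\<in>I. t - s) < \<delta>
        \<longrightarrow> (\<Sum>(s, t)\<in>I. norm (f t - f s)) < \<epsilon>)"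

(* Left Hadamard derivative of Caputo type, for 0 < \<alpha> \<le> 1. An absolutely continuous f is
   differentiable almost everywhere, so the arbitrary value of vector_derivative at the
   remaining points affects neither the integral nor, up to a null set, the case \<alpha> = 1.
   Likewise the integral exists for almost every t (and is 0 by convention elsewhere). *)
definition hadamard_deriv ::
    "real \<Rightarrow> real \<Rightarrow> (real \<Rightarrow> 'a::euclidean_space) \<Rightarrow> real \<Rightarrow> 'a" where
  "hadamard_deriv \<alpha> a f t =
     (if \<alpha> = 1 then t *\<^sub>R vector_derivative f (at t)
      else (1 / Gamma (1 - \<alpha>)) *\<^sub>R
        (LINT s:{a<..<t}|lebesgue.
           (ln (t / s) powr (- \<alpha>) / s) *\<^sub>R (s *\<^sub>R vector_derivative f (at s))))"

(* The norm of L^p((a,b), w(x) dx). As the Bochner integral of a non-integrable function is 0,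
   it is meaningful only for members of that space. *)
definition weighted_Lp_norm ::
    "real \<Rightarrow> (real \<Rightarrow> real) \<Rightarrow> real \<Rightarrow> real \<Rightarrow> (real \<Rightarrow> 'a::euclidean_space) \<Rightarrow> real" where
  "weighted_Lp_norm p w a b v =
     (LINT x:{a<..<b}|lebesgue. norm (v x) powr p * w x) powr (1 / p)"

definition in_weighted_Lp ::
    "real \<Rightarrow> (real \<Rightarrow> real) \<Rightarrow> real \<Rightarrow> real \<Rightarrow> (real \<Rightarrow> 'a::euclidean_space) \<Rightarrow> bool" where
  "in_weighted_Lp p w a b v \<longleftrightarrow>
     set_borel_measurable lebesgue {a<..<b} v \<and>
     set_integrable lebesgue {a<..<b} (\<lambda>x. norm (v x) powr p * w x)"

abbreviation Lp_norm ::
    "real \<Rightarrow> real \<Rightarrow> real \<Rightarrow> (real \<Rightarrow> 'a::euclidean_space) \<Rightarrow> real" where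
  "Lp_norm p \<equiv> weighted_Lp_norm p (\<lambda>_. 1)"

end

theory Submission
  imports Defs
begin

text \<open>
  An absolutely continuous \<open>u\<close> with \<open>u a = 0\<close> is the integral of its almost everywhere derivative.
  Write \<open>D\<close> for its Hadamard derivative of order \<open>\<alpha>\<close>. By Fubini and the Beta integral, the Hadamard
  integral of order \<open>\<alpha>\<close> inverts this derivative:
  \<open>\<Gamma>(\<alpha>) u(t) = \<integral>\<^sub>a\<^sup>t (log (t/s))\<^bsup>\<alpha>-1\<^esup> D(s) ds/s\<close>. Hoelder's inequality for the measure \<open>ds/s\<close> bounds \<open>u\<close>
  uniformly, and \<open>1/x \<le> 1/a\<close> finishes the proof. The theorem on absolutely continuous functions
  rests on two Vitali covering arguments (almost everywhere differentiability) and on the gauge integral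
  (integrability of the derivative).
\<close>

section \<open>Functions of bounded variation\<close>

text \<open>\<open>hadamard_deriv\<close> is built on \<open>vector_derivative\<close>, which is
  arbitrary where no derivative exists, so everything depends on recovering \<open>u\<close> from
  its derivative almost everywhere. Values in a Euclidean space cover the real and the complex case
  together. The inversion works because the product of the two logarithmic kernels, integrated from
  \<open>r\<close> to \<open>t\<close>, gives \<open>Gamma \<alpha> * Gamma (1 - \<alpha>)\<close>
  whatever \<open>r\<close> and \<open>t\<close> are. The constants come from the Hoelder step with
  q = p / (p - 1). The kernel is raised to the power (\<alpha> - 1) q, and its integral against ds/s
  is finite exactly when \<kappa> = (\<alpha> - 1) q + 1 is positive, that is, when \<alpha> > 1/p.
  This \<kappa> is the number raised to (p - 1)/p in the denominator, and \<kappa> / q = \<alpha> -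
  1/p is the exponent of the logarithm. The factor with b - a is the norm of the constant 1.\<close>

definition nonoverlapping :: "real \<Rightarrow> real \<Rightarrow> (real \<times> real) set \<Rightarrow> bool" where
  "nonoverlapping a b I \<longleftrightarrow> finite I \<and> (\<forall>k\<in>I. a \<le> fst k \<and> fst k < snd k \<and> snd k \<le> b) \<and>
     pairwise (\<lambda>k l. snd k \<le> fst l \<or> snd l \<le> fst k) I"

lemma nonoverlappingD:
  assumes "nonoverlapping a b I"
  shows "finite I" "k \<in> I \<Longrightarrow> a \<le> fst k" "k \<in> I \<Longrightarrow> fst k < snd k" "k \<in> I \<Longrightarrow> snd k \<le> b"
    "k \<in> I \<Longrightarrow> l \<in> I \<Longrightarrow> k \<noteq> l \<Longrightarrow> snd k \<le> fst l \<or> snd l \<le> fst k"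
  using assms unfolding nonoverlapping_def pairwise_def by blast+

lemma nonoverlapping_mono:
  "nonoverlapping c d I \<Longrightarrow> a \<le> c \<Longrightarrow> d \<le> b \<Longrightarrow> nonoverlapping a b I"
  unfolding nonoverlapping_def by force

text \<open>Serves to refine a partition cell by cell. A nondegenerate interval cannot lie in two
  cells, so the families \<open>E k\<close> are disjoint and sums split without double
  counting.\<close>

lemma nonoverlapping_Union:
  assumes "nonoverlapping a b P" and "\<And>k. k \<in> P \<Longrightarrow> nonoverlapping (fst k) (snd k) (E k)"
  shows "nonoverlapping a b (\<Union>k\<in>P. E k)"
    and "\<And>g. (\<Sum>l\<in>(\<Union>k\<in>P. E k). g l :: real) = (\<Sum>k\<in>P. \<Sum>l\<in>E k. g l)"
proof -
  note P = nonoverlappingD[OF assms(1)] and E = nonoverlappingD[OF assms(2)]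
  have sep: "snd l \<le> fst l' \<or> snd l' \<le> fst l"
    if "k \<in> P" "k' \<in> P" "l \<in> E k" "l' \<in> E k'" "k \<noteq> k'" for k k' l l'
    using P(5)[OF that(1,2,5)] E(2,4)[OF that(1,3)] E(2,4)[OF that(2,4)] by linarith
  show "nonoverlapping a b (\<Union>k\<in>P. E k)"
    unfolding nonoverlapping_def
  proof (intro conjI ballI)
    show "finite (\<Union>k\<in>P. E k)" using P(1) E(1) by blast
    fix l assume "l \<in> (\<Union>k\<in>P. E k)"
    then obtain k where k: "k \<in> P" "l \<in> E k" by blast
    show "a \<le> fst l" "fst l < snd l" "snd l \<le> b"
      using P(2,4)[OF k(1)] E(2,3,4)[OF k] by linarith+
  next
    show "pairwise (\<lambda>k l. snd k \<le> fst l \<or> snd l \<le> fst k) (\<Union>k\<in>P. E k)"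
      unfolding pairwise_def
    proof (intro ballI impI)
      fix l l' assume "l \<in> (\<Union>k\<in>P. E k)" "l' \<in> (\<Union>k\<in>P. E k)" "l \<noteq> l'"
      then obtain k k' where "k \<in> P" "l \<in> E k" "k' \<in> P" "l' \<in> E k'" by blast
      then show "snd l \<le> fst l' \<or> snd l' \<le> fst l"
        using sep[of k k' l l'] E(5)[of k l l'] \<open>l \<noteq> l'\<close> by (cases "k = k'") auto
    qed
  qed
  have "E k \<inter> E k' = {}" if "k \<in> P" "k' \<in> P" "k \<noteq> k'" for k k'
    using sep[OF that(1,2) _ _ that(3)] E(3)[OF that(1)] by fastforce
  then show "(\<Sum>l\<in>(\<Union>k\<in>P. E k). g l :: real) = (\<Sum>k\<in>P. \<Sum>l\<in>E k. g l)" for g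
    using P(1) E(1) by (intro sum.UNION_disjoint) auto
qed

text \<open>Filling the gaps yields a partition, over which increments telescope. The last
  conclusion provides, around every point that is not an endpoint, room for small intervals within
  one cell.\<close>

lemma nonoverlapping_extend:
  assumes "nonoverlapping a b D" "a < b"
  obtains D' where "D \<subseteq> D'" "nonoverlapping a b D'"
    "\<And>g :: real \<Rightarrow> real. (\<Sum>k\<in>D'. g (snd k) - g (fst k)) = g b - g a"
    "\<And>x. a < x \<Longrightarrow> x < b \<Longrightarrow> x \<notin> fst ` D' \<Longrightarrow> x \<notin> snd ` D' \<Longrightarrow> \<exists>k\<in>D'. fst k < x \<and> x < snd k"
proof -
  let ?Q = "\<lambda>a b D D'. D \<subseteq> D' \<and> nonoverlapping a b D' \<and>
    (\<forall>g :: real \<Rightarrow> real. (\<Sum>k\<in>D'. g (snd k) - g (fst k)) = g b - g a) \<and>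
    (\<forall>x. a < x \<longrightarrow> x < b \<longrightarrow> x \<notin> fst ` D' \<longrightarrow> x \<notin> snd ` D' \<longrightarrow> (\<exists>k\<in>D'. fst k < x \<and> x < snd k))"
  have "finite D" using assms nonoverlappingD by blast
  \<comment> \<open>Removing one interval leaves a family on its left and one on its right, to which
    the induction hypothesis applies. These outer pieces may shrink to a point, hence
    \<open>a \<le> b\<close> in place of \<open>a < b\<close>.\<close>
  then have "\<exists>D'. ?Q a b D D'" if "nonoverlapping a b D" "a \<le> b" for a b
    using that
  proof (induction D arbitrary: a b rule: finite_psubset_induct)
    case (psubset D)
    show ?case
    proof (cases "D = {}")
      case True
      show ?thesis
      proof (cases "a = b")
        case True
        then show ?thesis using \<open>D = {}\<close> by (intro exI[of _ "{}"]) (auto simp: nonoverlapping_def)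
      next
        case False
        then show ?thesis using \<open>D = {}\<close> psubset.prems
          by (intro exI[of _ "{(a, b)}"]) (auto simp: nonoverlapping_def)
      qed
    next
      case False
      then obtain s t where st: "(s, t) \<in> D" by auto
      note D = nonoverlappingD[OF psubset.prems(1)]
      have le: "a \<le> s" "s < t" "t \<le> b" using D(2,3,4)[OF st] by auto
      define L where "L = {k\<in>D. snd k \<le> s}"
      define R where "R = {k\<in>D. t \<le> fst k}"
      have "(s, t) \<notin> L" "(s, t) \<notin> R" using le by (auto simp: L_def R_def)
      moreover have "L \<subseteq> D" "R \<subseteq> D" by (auto simp: L_def R_def)
      ultimately have sub: "L \<subset> D" "R \<subset> D" using st by blast+
      have DLR: "D \<subseteq> insert (s, t) (L \<union> R)"
        using D(5)[OF st] by (auto simp: L_def R_def)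
      have "nonoverlapping a s L" "nonoverlapping t b R"
        using psubset.prems(1) sub unfolding nonoverlapping_def L_def R_def
        by (auto simp: pairwise_def)
      then have "\<exists>L'. ?Q a s L L'" "\<exists>R'. ?Q t b R R'"
        using psubset.IH[OF sub(1), of a s] psubset.IH[OF sub(2), of t b] le by simp_all
      then obtain L' R' where L': "?Q a s L L'" and R': "?Q t b R R'" by (elim exE)
      note L'n = nonoverlappingD[of a s L'] and R'n = nonoverlappingD[of t b R']
      have Lk: "a \<le> fst k" "fst k < snd k" "snd k \<le> s" if "k \<in> L'" for k
        using L'n that L' by blast+
      have Rk: "t \<le> fst k" "fst k < snd k" "snd k \<le> b" if "k \<in> R'" for k
        using R'n that R' by blast+
      have notin: "(s, t) \<notin> L' \<union> R'" "L' \<inter> R' = {}"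
        using Lk Rk le by fastforce+
      have fin: "finite L'" "finite R'" using L' R' nonoverlappingD by blast+
      let ?E = "insert (s, t) (L' \<union> R')"
      have "?Q a b D ?E"
      proof (intro conjI allI impI)
        show "D \<subseteq> ?E" using DLR L' R' by blast
        show "nonoverlapping a b ?E"
          unfolding nonoverlapping_def
        proof (intro conjI ballI)
          show "finite ?E" using fin by simp
          show "a \<le> fst k" "fst k < snd k" "snd k \<le> b" if "k \<in> ?E" for k
            using that le Lk[of k] Rk[of k] by auto
          show "pairwise (\<lambda>k l. snd k \<le> fst l \<or> snd l \<le> fst k) ?E"
            unfolding pairwise_def
          proof (intro ballI impI)
            fix k l assume kl: "k \<in> ?E" "l \<in> ?E" "k \<noteq> l"
            consider "k \<in> L'" "l \<in> L'" | "k \<in> R'" "l \<in> R'" | "k \<in> L'" "l \<in> R'" | "k \<in> R'" "l \<in> L'"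
              | "k = (s, t)" | "l = (s, t)" using kl by blast
            then show "snd k \<le> fst l \<or> snd l \<le> fst k"
            proof cases
              case 1 then show ?thesis using L' kl nonoverlappingD(5) by blast
            next
              case 2 then show ?thesis using R' kl nonoverlappingD(5) by blast
            next
              case 3 then show ?thesis using Lk(3)[of k] Rk(1)[of l] le by linarith
            next
              case 4 then show ?thesis using Lk(3)[of l] Rk(1)[of k] le by linarith
            next
              case 5 then show ?thesis using Lk(3)[of l] Rk(1)[of l] kl by auto
            next
              case 6 then show ?thesis using Lk(3)[of k] Rk(1)[of k] kl by auto
            qed
          qed
        qed
        show "(\<Sum>k\<in>?E. g (snd k) - g (fst k)) = g b - g a" for g :: "real \<Rightarrow> real"
        proof -
          have "(\<Sum>k\<in>?E. g (snd k) - g (fst k)) = g t - g s + ((g s - g a) + (g b - g t))"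
            using fin notin L' R' by (simp add: sum.union_disjoint)
          then show ?thesis by simp
        qed
        fix x assume x: "a < x" "x < b" "x \<notin> fst ` ?E" "x \<notin> snd ` ?E"
        consider "x < s" | "x = s" | "s < x" "x < t" | "x = t" | "t < x" by linarith
        then show "\<exists>k\<in>?E. fst k < x \<and> x < snd k"
        proof cases
          case 1
          moreover have "x \<notin> fst ` L'" "x \<notin> snd ` L'" using x by auto
          ultimately show ?thesis using L' x by blast
        next
          case 2 then show ?thesis using x by auto
        next
          case 3 then show ?thesis by auto
        next
          case 5
          moreover have "x \<notin> fst ` R'" "x \<notin> snd ` R'" using x by auto
          ultimately show ?thesis using R' x by blast
        next
          case 4 then show ?thesis using x by auto
        qed
      qed
      then show ?thesis by blast
    qed
  qed
  then have "\<exists>D'. ?Q a b D D'" using assms by simp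
  then obtain D' where "?Q a b D D'" by (elim exE)
  then show ?thesis by (intro that[of D']) simp_all
qed

lemma nonoverlapping_sum_length_le:
  assumes "nonoverlapping a b I" "a < b"
  shows "(\<Sum>k\<in>I. snd k - fst k) \<le> b - a"
proof -
  obtain D where D: "I \<subseteq> D" "nonoverlapping a b D"
    "\<And>g :: real \<Rightarrow> real. (\<Sum>k\<in>D. g (snd k) - g (fst k)) = g b - g a"
    using nonoverlapping_extend[OF assms] by metis
  have "(\<Sum>k\<in>I. snd k - fst k) \<le> (\<Sum>k\<in>D. snd k - fst k)"
    using D(1) nonoverlappingD[OF D(2)] by (intro sum_mono2) force+
  also have "\<dots> = b - a" using D(3)[of "\<lambda>x. x"] by simp
  finally show ?thesis .
qed

section \<open>Vitali coverings and Lebesgue's differentiation theorem\<close>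

text \<open>The Vitali theorem selects countably many disjoint intervals of \<open>K\<close> that
  cover \<open>S - F\<close> up to a null set. Finite parts of the selection are nonoverlapping,
  hence of total length at most \<open>e\<close>, and this bound passes to the countable union. Both
  \<open>K\<close> and the null set \<open>F\<close> may depend on \<open>e\<close>.\<close>

lemma negligible_if_Vitali_cover:
  fixes S :: "real set"
  assumes "\<And>e. 0 < e \<Longrightarrow> \<exists>K F. negligible F \<and>
      (\<forall>x\<in>S - F. \<forall>d>0. \<exists>k\<in>K. fst k \<le> x \<and> x \<le> snd k \<and> snd k - fst k < d) \<and>
      (\<forall>k\<in>K. a \<le> fst k \<and> fst k < snd k \<and> snd k \<le> b) \<and>
      (\<forall>D\<subseteq>K. nonoverlapping a b D \<longrightarrow> (\<Sum>k\<in>D. snd k - fst k) \<le> e)"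
  shows "negligible S"
  unfolding negligible_outer_le
proof (intro allI impI)
  fix e :: real assume "0 < e"
  from assms[OF this] obtain K F where F: "negligible F"
    and cov: "\<forall>x\<in>S - F. \<forall>d>0. \<exists>k\<in>K. fst k \<le> x \<and> x \<le> snd k \<and> snd k - fst k < d"
    and K: "\<forall>k\<in>K. a \<le> fst k \<and> fst k < snd k \<and> snd k \<le> b"
    and len: "\<forall>D\<subseteq>K. nonoverlapping a b D \<longrightarrow> (\<Sum>k\<in>D. snd k - fst k) \<le> e"
    by (elim exE conjE)
  \<comment> \<open>The covering theorem speaks of balls, so intervals are described by midpoint and
    half-length.\<close>
  define m where "m k = (fst k + snd k) / 2" for k :: "real \<times> real"
  define r where "r k = (snd k - fst k) / 2" for k :: "real \<times> real"
  have ball: "cball (m k) (r k) = {fst k..snd k}" for k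
  proof -
    have "m k - r k = fst k" "m k + r k = snd k" by (simp_all add: m_def r_def field_simps)
    then show ?thesis by (simp add: cball_eq_atLeastAtMost)
  qed
  obtain C where C: "countable C" "C \<subseteq> K"
    "pairwise (\<lambda>i j. disjnt (cball (m i) (r i)) (cball (m j) (r j))) C"
    "negligible ((S - F) - (\<Union>i\<in>C. cball (m i) (r i)))"
  proof (rule Vitali_covering_theorem_cballs[where a = m and r = r and K = K and S = "S - F"])
    show "0 < r i" if "i \<in> K" for i using K that by (simp add: r_def)
    show "\<exists>i. i \<in> K \<and> x \<in> cball (m i) (r i) \<and> r i < d" if "x \<in> S - F" "0 < d" for x d
    proof -
      obtain k where k: "k \<in> K" "fst k \<le> x" "x \<le> snd k" "snd k - fst k < d"
        using bspec[OF cov \<open>x \<in> S - F\<close>] \<open>0 < d\<close> by blast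
      then have "r k < d" using K by (force simp: r_def)
      then show ?thesis using k unfolding ball by (intro exI[of _ k]) auto
    qed
  qed auto
  have le: "measure lebesgue (\<Union>i\<in>D. cball (m i) (r i)) \<le> e" if D: "D \<subseteq> C" "finite D" for D
  proof -
    have "nonoverlapping a b D"
      unfolding nonoverlapping_def pairwise_def
    proof (intro conjI ballI impI)
      fix k l assume kl: "k \<in> D" "l \<in> D" "k \<noteq> l"
      then have "disjnt {fst k..snd k} {fst l..snd l}"
        using C(3) D unfolding ball pairwise_def by blast
      moreover have "fst k < snd k" "fst l < snd l" using K C(2) D kl by auto
      ultimately show "snd k \<le> fst l \<or> snd l \<le> fst k"
        unfolding disjnt_iff atLeastAtMost_iff by (smt (verit))
    qed (use K C(2) D in auto)
    then have "(\<Sum>k\<in>D. snd k - fst k) \<le> e" using len D C(2) by blast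
    moreover have "measure lebesgue (\<Union>i\<in>D. cball (m i) (r i)) \<le> (\<Sum>k\<in>D. measure lebesgue (cball (m k) (r k)))"
      using D(2) by (intro measure_UNION_le) auto
    moreover have "\<dots> = (\<Sum>k\<in>D. snd k - fst k)"
    proof (rule sum.cong)
      fix k assume "k \<in> D"
      then have "fst k < snd k" using K C(2) D by auto
      then show "measure lebesgue (cball (m k) (r k)) = snd k - fst k" unfolding ball by simp
    qed simp
    ultimately show ?thesis by simp
  qed
  let ?U = "\<Union>i\<in>C. cball (m i) (r i)" and ?N = "(S - F) - (\<Union>i\<in>C. cball (m i) (r i)) \<union> F"
  have U: "?U \<in> lmeasurable" "measure lebesgue ?U \<le> e"
    using fmeasurable_UN_bound[OF C(1) _ le] measure_UN_bound[OF C(1) _ le] by simp_all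
  have N: "negligible ?N" using C(4) F by simp
  show "\<exists>T. S \<subseteq> T \<and> T \<in> lmeasurable \<and> measure lebesgue T \<le> e"
  proof (intro exI conjI)
    show "S \<subseteq> ?U \<union> ?N" by blast
    show "?U \<union> ?N \<in> lmeasurable" using U N by (simp add: fmeasurable.Un negligible_imp_measurable)
    show "measure lebesgue (?U \<union> ?N) \<le> e" using U N
      by (simp add: measure_Un_null_set negligible_iff_null_sets fmeasurableD)
  qed
qed

text \<open>Nonoverlapping intervals of slope at least \<open>M\<close> consume variation
  \<open>M\<close> times their total length, which is therefore at most \<open>B / M\<close>; and
  \<open>M\<close> is arbitrary.\<close>

lemma unbounded_slopes_negligible:
  assumes var: "\<And>I. nonoverlapping a b I \<Longrightarrow> (\<Sum>k\<in>I. \<bar>f (snd k) - f (fst k)\<bar>) \<le> B"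
    and steep: "\<And>x M d. x \<in> S \<Longrightarrow> 0 < M \<Longrightarrow> 0 < d \<Longrightarrow> \<exists>s t. a \<le> s \<and> s \<le> x \<and> x \<le> t \<and> t \<le> b \<and>
        s < t \<and> t - s < d \<and> M * (t - s) \<le> \<bar>f t - f s :: real\<bar>"
  shows "negligible S"
proof (rule negligible_if_Vitali_cover[where a = a and b = b])
  fix e :: real assume e: "0 < e"
  have "0 \<le> B" using var[of "{}"] by (simp add: nonoverlapping_def)
  \<comment> \<open>The \<open>+ 1\<close> keeps \<open>M\<close> positive even for
    \<open>B = 0\<close>; \<open>M * e\<close> still bounds the variation.\<close>
  define M where "M = (B + 1) / e"
  have M: "0 < M" using e \<open>0 \<le> B\<close> by (simp add: M_def)
  define K where "K = {(s, t). a \<le> s \<and> t \<le> b \<and> s < t \<and> M * (t - s) \<le> \<bar>f t - f s\<bar>}"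
  have "(\<Sum>k\<in>D. snd k - fst k) \<le> e" if D: "D \<subseteq> K" "nonoverlapping a b D" for D
  proof -
    have "M * (\<Sum>k\<in>D. snd k - fst k) \<le> (\<Sum>k\<in>D. \<bar>f (snd k) - f (fst k)\<bar>)"
      unfolding sum_distrib_left using D(1) by (intro sum_mono) (auto simp: K_def)
    also have "\<dots> \<le> M * e" using var[OF D(2)] e by (simp add: M_def)
    finally show ?thesis using M by simp
  qed
  moreover have "\<exists>k\<in>K. fst k \<le> x \<and> x \<le> snd k \<and> snd k - fst k < d" if "x \<in> S" "0 < d" for x d
    using steep[OF that(1) M that(2)] unfolding K_def by force
  ultimately show "\<exists>K F. negligible F \<and>
      (\<forall>x\<in>S - F. \<forall>d>0. \<exists>k\<in>K. fst k \<le> x \<and> x \<le> snd k \<and> snd k - fst k < d) \<and>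
      (\<forall>k\<in>K. a \<le> fst k \<and> fst k < snd k \<and> snd k \<le> b) \<and>
      (\<forall>D\<subseteq>K. nonoverlapping a b D \<longrightarrow> (\<Sum>k\<in>D. snd k - fst k) \<le> e)"
    by (intro exI[of _ K] exI[of _ "{}"]) (auto simp: K_def)
qed

text \<open>Once the gaps are filled, the signed increments add up to the net increment. Replacing
  them by absolute values loses nothing outside \<open>D\<close> and gains at least
  \<open>2 * c\<close> times the length on \<open>D\<close>, where an increment of size at least
  \<open>c\<close> times the length changes its sign.\<close>

lemma variation_ge_opposite:
  fixes f :: "real \<Rightarrow> real"
  assumes D: "nonoverlapping u v D" and "u < v" and \<sigma>: "\<sigma> = 1 \<or> \<sigma> = -1"
    and sgn: "\<bar>f v - f u\<bar> = \<sigma> * (f v - f u)"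
    and opp: "\<And>k. k \<in> D \<Longrightarrow> c * (snd k - fst k) \<le> - \<sigma> * (f (snd k) - f (fst k))"
  obtains E where "nonoverlapping u v E"
    "\<bar>f v - f u\<bar> + 2 * c * (\<Sum>k\<in>D. snd k - fst k) \<le> (\<Sum>k\<in>E. \<bar>f (snd k) - f (fst k)\<bar>)"
proof -
  obtain E where E: "D \<subseteq> E" "nonoverlapping u v E"
    "\<And>g :: real \<Rightarrow> real. (\<Sum>k\<in>E. g (snd k) - g (fst k)) = g v - g u"
    using nonoverlapping_extend[OF D \<open>u < v\<close>] by metis
  have fin: "finite E" using nonoverlappingD[OF E(2)] by blast
  let ?\<Delta> = "\<lambda>k. f (snd k) - f (fst k)"
  have "\<bar>f v - f u\<bar> = \<sigma> * (\<Sum>k\<in>E. ?\<Delta> k)" using E(3)[of f] sgn by simp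
  also have "\<dots> = (\<Sum>k\<in>E - D. \<sigma> * ?\<Delta> k) + (\<Sum>k\<in>D. \<sigma> * ?\<Delta> k)"
    using sum.subset_diff[OF E(1) fin] by (simp add: sum_distrib_left)
  also have "\<dots> \<le> (\<Sum>k\<in>E - D. \<bar>?\<Delta> k\<bar>) + (\<Sum>k\<in>D. \<bar>?\<Delta> k\<bar> - 2 * c * (snd k - fst k))"
  proof (intro add_mono sum_mono)
    show "\<sigma> * ?\<Delta> k \<le> \<bar>?\<Delta> k\<bar>" for k using \<sigma> by auto
    show "\<sigma> * ?\<Delta> k \<le> \<bar>?\<Delta> k\<bar> - 2 * c * (snd k - fst k)" if "k \<in> D" for k
      using opp[OF that] \<sigma> by auto
  qed
  also have "\<dots> = (\<Sum>k\<in>E. \<bar>?\<Delta> k\<bar>) - 2 * c * (\<Sum>k\<in>D. snd k - fst k)"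
  proof -
    have "(\<Sum>k\<in>D. \<bar>?\<Delta> k\<bar> - 2 * c * (snd k - fst k)) = (\<Sum>k\<in>D. \<bar>?\<Delta> k\<bar>) - 2 * c * (\<Sum>k\<in>D. snd k - fst k)"
      by (subst sum_subtractf) (simp only: sum_distrib_left)
    then show ?thesis using sum.subset_diff[OF E(1) fin, of "\<lambda>k. \<bar>?\<Delta> k\<bar>"] by simp
  qed
  finally show ?thesis using that E(2) by auto
qed

text \<open>Choose a partition \<open>P\<close> whose variation is within \<open>2ce\<close> of the supremum. Inside an interval
  of \<open>P\<close> use only the steep subintervals whose slope has the sign opposite to the increment of \<open>f\<close>
  over that interval: inserting disjoint ones of total length \<open>l\<close> raises the variation by at least
  \<open>2cl\<close>, whence \<open>l \<le> e\<close>. Taking a near-optimal partition replaces the usual detour through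
  monotone functions.\<close>

lemma symmetric_oscillation_negligible:
  fixes f :: "real \<Rightarrow> real"
  assumes var: "\<And>I. nonoverlapping a b I \<Longrightarrow> (\<Sum>k\<in>I. \<bar>f (snd k) - f (fst k)\<bar>) \<le> B"
    and "0 < c" "a < b" and S: "S \<subseteq> {a<..<b}"
    and osc: "\<And>x d \<sigma>. x \<in> S \<Longrightarrow> 0 < d \<Longrightarrow> \<sigma> = 1 \<or> \<sigma> = -1 \<Longrightarrow>
      \<exists>s t. s \<le> x \<and> x \<le> t \<and> s < t \<and> t - s < d \<and> c * (t - s) \<le> \<sigma> * (f t - f s)"
  shows "negligible S"
proof (rule negligible_if_Vitali_cover[where a = a and b = b])
  fix e :: real assume e: "0 < e"
  let ?\<Delta> = "\<lambda>k. f (snd k) - f (fst k)"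
  let ?var = "\<lambda>I. \<Sum>k\<in>I. \<bar>?\<Delta> k\<bar>"
  define W where "W = ?var ` {I. nonoverlapping a b I}"
  have bdd: "bdd_above W" using var by (auto simp: W_def bdd_above_def)
  have "{} \<in> {I. nonoverlapping a b I}" by (simp add: nonoverlapping_def)
  then have "W \<noteq> {}" unfolding W_def by blast
  have "Sup W - 2 * c * e < Sup W" using e \<open>0 < c\<close> by simp
  then obtain P0 where P0: "nonoverlapping a b P0" "Sup W - 2 * c * e < ?var P0"
    using less_cSup_iff[OF \<open>W \<noteq> {}\<close> bdd] unfolding W_def by auto
  obtain P where P: "P0 \<subseteq> P" "nonoverlapping a b P"
    and cov: "\<And>x. a < x \<Longrightarrow> x < b \<Longrightarrow> x \<notin> fst ` P \<Longrightarrow> x \<notin> snd ` P \<Longrightarrow> \<exists>k\<in>P. fst k < x \<and> x < snd k"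
    using nonoverlapping_extend[OF P0(1) \<open>a < b\<close>] by metis
  note PD = nonoverlappingD[OF P(2)]
  have "?var P0 \<le> ?var P" using P(1) PD(1) by (intro sum_mono2) auto
  with P0(2) have PW: "Sup W - 2 * c * e < ?var P" by simp
  define \<sigma> where "\<sigma> J = (if 0 \<le> ?\<Delta> J then 1 else -1 :: real)" for J
  have \<sigma>: "\<sigma> J = 1 \<or> \<sigma> J = -1" "\<bar>?\<Delta> J\<bar> = \<sigma> J * ?\<Delta> J" for J
    by (auto simp: \<sigma>_def)
  define L where "L J = {k. fst J \<le> fst k \<and> snd k \<le> snd J \<and> fst k < snd k \<and>
      c * (snd k - fst k) \<le> - \<sigma> J * ?\<Delta> k}" for J
  define K where "K = (\<Union>J\<in>P. L J)"
  \<comment> \<open>The endpoints form a finite set. Every other point of \<open>S\<close> is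
    interior to a cell \<open>J\<close>, and this cell determines which direction counts as
    opposite.\<close>
  define F where "F = fst ` P \<union> snd ` P"
  have "negligible F" unfolding F_def using PD(1) by (simp add: negligible_finite)
  moreover have "\<exists>k\<in>K. fst k \<le> x \<and> x \<le> snd k \<and> snd k - fst k < d" if x: "x \<in> S - F" and d: "0 < d" for x d
  proof -
    obtain J where J: "J \<in> P" "fst J < x" "x < snd J"
      using cov[of x] x S unfolding F_def by (meson DiffE UnCI greaterThanLessThan_iff subsetD)
    \<comment> \<open>Small enough for an interval of this length around \<open>x\<close> to remain
      inside \<open>J\<close>.\<close>
    define d' where "d' = min d (min (x - fst J) (snd J - x))"
    have "0 < d'" using d J by (simp add: d'_def)
    then obtain s t where "s \<le> x" "x \<le> t" "s < t" "t - s < d'" "c * (t - s) \<le> - \<sigma> J * (f t - f s)"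
      using osc[of x d' "- \<sigma> J"] \<sigma>(1)[of J] x by auto
    then have "(s, t) \<in> L J" "t - s < d" by (auto simp: L_def d'_def)
    then show ?thesis unfolding K_def using J \<open>s \<le> x\<close> \<open>x \<le> t\<close> by force
  qed
  moreover have "a \<le> fst k \<and> fst k < snd k \<and> snd k \<le> b" if "k \<in> K" for k
    using that PD(2,4) unfolding K_def L_def by force
  moreover have "(\<Sum>k\<in>D. snd k - fst k) \<le> e" if D: "D \<subseteq> K" "nonoverlapping a b D" for D
  proof -
    have sub: "nonoverlapping (fst J) (snd J) (D \<inter> L J)" for J
      using D(2) unfolding nonoverlapping_def pairwise_def L_def by auto
    have "\<exists>E. nonoverlapping (fst J) (snd J) E \<and> \<bar>?\<Delta> J\<bar> + 2 * c * (\<Sum>k\<in>D \<inter> L J. snd k - fst k) \<le> ?var E"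
      if "J \<in> P" for J
    proof (rule variation_ge_opposite[OF sub PD(3)[OF that] \<sigma>(1)[of J] \<sigma>(2)])
      show "c * (snd k - fst k) \<le> - \<sigma> J * ?\<Delta> k" if "k \<in> D \<inter> L J" for k
        using that by (simp add: L_def)
    qed blast
    then have "\<forall>J\<in>P. \<exists>E. nonoverlapping (fst J) (snd J) E \<and>
        \<bar>?\<Delta> J\<bar> + 2 * c * (\<Sum>k\<in>D \<inter> L J. snd k - fst k) \<le> ?var E" by blast
    from bchoice[OF this] obtain E where "\<forall>J\<in>P. nonoverlapping (fst J) (snd J) (E J) \<and>
        \<bar>?\<Delta> J\<bar> + 2 * c * (\<Sum>k\<in>D \<inter> L J. snd k - fst k) \<le> ?var (E J)" by (elim exE)
    then have E: "\<And>J. J \<in> P \<Longrightarrow> nonoverlapping (fst J) (snd J) (E J)"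
      "\<And>J. J \<in> P \<Longrightarrow> \<bar>?\<Delta> J\<bar> + 2 * c * (\<Sum>k\<in>D \<inter> L J. snd k - fst k) \<le> ?var (E J)" by blast+
    have "D = (\<Union>J\<in>P. D \<inter> L J)" using D(1) unfolding K_def by blast
    then have "(\<Sum>k\<in>D. snd k - fst k) = (\<Sum>J\<in>P. \<Sum>k\<in>D \<inter> L J. snd k - fst k)"
      using nonoverlapping_Union(2)[OF P(2) sub, of "\<lambda>k. snd k - fst k"] by simp
    then have "?var P + 2 * c * (\<Sum>k\<in>D. snd k - fst k)
        = (\<Sum>J\<in>P. \<bar>?\<Delta> J\<bar> + 2 * c * (\<Sum>k\<in>D \<inter> L J. snd k - fst k))"
      by (simp add: sum.distrib sum_distrib_left)
    also have "\<dots> \<le> (\<Sum>J\<in>P. ?var (E J))" by (intro sum_mono E(2))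
    also have "\<dots> = ?var (\<Union>J\<in>P. E J)"
      using nonoverlapping_Union(2)[OF P(2) E(1), of "\<lambda>k. \<bar>?\<Delta> k\<bar>"] by simp
    also have "\<dots> \<le> Sup W"
      using bdd nonoverlapping_Union(1)[OF P(2) E(1)] by (intro cSup_upper) (auto simp: W_def)
    finally have "2 * c * (\<Sum>k\<in>D. snd k - fst k) \<le> 2 * c * e" using PW by simp
    then show ?thesis using \<open>0 < c\<close> by simp
  qed
  ultimately show "\<exists>K F. negligible F \<and>
      (\<forall>x\<in>S - F. \<forall>d>0. \<exists>k\<in>K. fst k \<le> x \<and> x \<le> snd k \<and> snd k - fst k < d) \<and>
      (\<forall>k\<in>K. a \<le> fst k \<and> fst k < snd k \<and> snd k \<le> b) \<and>
      (\<forall>D\<subseteq>K. nonoverlapping a b D \<longrightarrow> (\<Sum>k\<in>D. snd k - fst k) \<le> e)"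
    by blast
qed


text \<open>The derivative is the supremum of the numbers that bound all slopes over sufficiently
  short intervals around \<open>x\<close> from below. A rational \<open>p\<close> above it is no
  such bound, so \<open>settle\<close> supplies upper bounds \<open>q\<close> as close to it as
  desired. Restricting \<open>p\<close> and \<open>q\<close> to rationals will leave only countably
  many exceptional sets. Intervals having \<open>x\<close> as an endpoint turn slopes into
  difference quotients.\<close>

lemma differentiable_if_slopes_settle:
  fixes f :: "real \<Rightarrow> real"
  assumes bdd: "0 < d0" "\<And>s t. s \<le> x \<Longrightarrow> x \<le> t \<Longrightarrow> s < t \<Longrightarrow> t - s < d0 \<Longrightarrow> \<bar>f t - f s\<bar> \<le> M * (t - s)"
    and settle: "\<And>p q. p \<in> \<rat> \<Longrightarrow> q \<in> \<rat> \<Longrightarrow> p < q \<Longrightarrow> \<exists>d>0.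
      (\<forall>s t. s \<le> x \<longrightarrow> x \<le> t \<longrightarrow> s < t \<longrightarrow> t - s < d \<longrightarrow> p * (t - s) \<le> f t - f s) \<or>
      (\<forall>s t. s \<le> x \<longrightarrow> x \<le> t \<longrightarrow> s < t \<longrightarrow> t - s < d \<longrightarrow> f t - f s \<le> q * (t - s))"
  shows "f differentiable at x"
proof -
  define low where "low r d \<longleftrightarrow> (\<forall>s t. s \<le> x \<longrightarrow> x \<le> t \<longrightarrow> s < t \<longrightarrow> t - s < d \<longrightarrow> r * (t - s) \<le> f t - f s)" for r d
  define up where "up r d \<longleftrightarrow> (\<forall>s t. s \<le> x \<longrightarrow> x \<le> t \<longrightarrow> s < t \<longrightarrow> t - s < d \<longrightarrow> f t - f s \<le> r * (t - s))" for r d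
  define A where "A = {r. \<exists>d>0. low r d}"
  have "- M * (t - s) \<le> f t - f s" if "s \<le> x" "x \<le> t" "s < t" "t - s < d0" for s t
    using bdd(2)[OF that] by (simp add: abs_le_iff)
  then have "low (- M) d0" unfolding low_def by blast
  then have "- M \<in> A" using bdd(1) by (auto simp: A_def)
  have le: "r \<le> M" if "r \<in> A" for r
  proof -
    obtain d where d: "0 < d" "low r d" using \<open>r \<in> A\<close> by (auto simp: A_def)
    define t where "t = x + min d d0 / 2"
    have t: "x < t" "t - x < d" "t - x < d0" using d bdd(1) by (auto simp: t_def min_def)
    then have "r * (t - x) \<le> M * (t - x)"
      using d(2)[unfolded low_def, rule_format, of x t] bdd(2)[of x t] by linarith
    then show ?thesis using t by simp
  qed
  then have bA: "bdd_above A" by (auto simp: bdd_above_def)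
  define L where "L = Sup A"
  have "(f has_real_derivative L) (at x)"
    unfolding has_field_derivative_def has_derivative_at_alt
  proof (intro conjI allI impI bounded_linear_mult_right)
    fix e :: real assume e: "0 < e"
    obtain r where r: "r \<in> A" "L - e < r"
      using less_cSup_iff[of A "L - e"] \<open>- M \<in> A\<close> bA e unfolding L_def by auto
    then obtain d1 where d1: "0 < d1" "low r d1" by (auto simp: A_def)
    obtain p where p: "p \<in> \<rat>" "L < p" "p < L + e" using Rats_dense_in_real[of L "L + e"] e by auto
    obtain q where q: "q \<in> \<rat>" "p < q" "q < L + e" using Rats_dense_in_real[OF p(3)] by auto
    have "p \<notin> A" using p cSup_upper[OF _ bA, of p] unfolding L_def by auto
    then obtain d2 where d2: "0 < d2" "up q d2"
      using settle[OF p(1) q(1,2)] unfolding A_def low_def up_def by blast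
    have main: "\<bar>f t - f s - L * (t - s)\<bar> \<le> e * (t - s)"
      if st: "s \<le> x" "x \<le> t" "s < t" "t - s < min d1 d2" for s t
    proof -
      have "r * (t - s) \<le> f t - f s" "f t - f s \<le> q * (t - s)"
        using d1(2) d2(2) st unfolding low_def up_def by auto
      moreover have "(L - e) * (t - s) \<le> r * (t - s)" "q * (t - s) \<le> (L + e) * (t - s)"
        using r q st by (intro mult_right_mono; simp)+
      ultimately show ?thesis by (simp add: algebra_simps abs_le_iff)
    qed
    show "\<exists>d>0. \<forall>y. norm (y - x) < d \<longrightarrow> norm (f y - f x - L * (y - x)) \<le> e * norm (y - x)"
    proof (intro exI[of _ "min d1 d2"] conjI allI impI)
      fix y assume y: "norm (y - x) < min d1 d2"
      consider "y < x" | "y = x" | "x < y" by linarith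
      then show "norm (f y - f x - L * (y - x)) \<le> e * norm (y - x)"
      proof cases
        case 1
        then have "\<bar>f x - f y - L * (x - y)\<bar> \<le> e * (x - y)" using main[of y x] y by simp
        moreover have "f y - f x - L * (y - x) = - (f x - f y - L * (x - y))" by (simp add: algebra_simps)
        ultimately show ?thesis using 1 by (simp only: abs_minus_cancel real_norm_def) simp
      next
        case 3
        then show ?thesis using main[of x y] y by simp
      qed simp
    qed (use d1 d2 in simp)
  qed
  then show ?thesis by (auto simp: differentiable_def has_field_derivative_def)
qed

text \<open>Subtracting a linear function whose slope \<open>m\<close> is the mean of
  \<open>p\<close> and \<open>q\<close> moves these two slopes to \<open>- c\<close> and
  \<open>c\<close>, the symmetric case. The variation grows by at most
  \<open>\<bar>m\<bar> * (b - a)\<close>.\<close>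

lemma oscillation_negligible:
  fixes f :: "real \<Rightarrow> real"
  assumes var: "\<And>I. nonoverlapping a b I \<Longrightarrow> (\<Sum>k\<in>I. \<bar>f (snd k) - f (fst k)\<bar>) \<le> B"
    and "p < q" "a < b" and S: "S \<subseteq> {a<..<b}"
    and lo: "\<And>x d. x \<in> S \<Longrightarrow> 0 < d \<Longrightarrow>
      \<exists>s t. s \<le> x \<and> x \<le> t \<and> s < t \<and> t - s < d \<and> f t - f s \<le> p * (t - s)"
    and hi: "\<And>x d. x \<in> S \<Longrightarrow> 0 < d \<Longrightarrow>
      \<exists>s t. s \<le> x \<and> x \<le> t \<and> s < t \<and> t - s < d \<and> q * (t - s) \<le> f t - f s"
  shows "negligible S"
proof -
  define m where "m = (p + q) / 2"
  define c where "c = (q - p) / 2"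
  have pq: "p = m - c" "q = m + c" "0 < c" using \<open>p < q\<close> by (simp_all add: m_def c_def field_simps)
  show ?thesis
  proof (rule symmetric_oscillation_negligible[where f = "\<lambda>x. f x - m * x" and B = "B + \<bar>m\<bar> * (b - a)"])
    fix I assume I: "nonoverlapping a b I"
    have "(\<Sum>k\<in>I. \<bar>f (snd k) - m * snd k - (f (fst k) - m * fst k)\<bar>)
        \<le> (\<Sum>k\<in>I. \<bar>f (snd k) - f (fst k)\<bar> + \<bar>m\<bar> * (snd k - fst k))"
    proof (rule sum_mono)
      fix k assume "k \<in> I"
      then have "fst k < snd k" using nonoverlappingD[OF I] by blast
      then have "\<bar>m * (snd k - fst k)\<bar> = \<bar>m\<bar> * (snd k - fst k)" by (simp add: abs_mult)
      moreover have "f (snd k) - m * snd k - (f (fst k) - m * fst k)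
          = (f (snd k) - f (fst k)) - m * (snd k - fst k)" by (simp add: algebra_simps)
      ultimately show "\<bar>f (snd k) - m * snd k - (f (fst k) - m * fst k)\<bar>
          \<le> \<bar>f (snd k) - f (fst k)\<bar> + \<bar>m\<bar> * (snd k - fst k)"
        by (metis abs_triangle_ineq4)
    qed
    also have "\<dots> = (\<Sum>k\<in>I. \<bar>f (snd k) - f (fst k)\<bar>) + \<bar>m\<bar> * (\<Sum>k\<in>I. snd k - fst k)"
      by (simp add: sum.distrib sum_distrib_left)
    also have "\<dots> \<le> B + \<bar>m\<bar> * (b - a)"
      by (intro add_mono mult_left_mono var nonoverlapping_sum_length_le I \<open>a < b\<close>) simp
    finally show "(\<Sum>k\<in>I. \<bar>f (snd k) - m * snd k - (f (fst k) - m * fst k)\<bar>) \<le> B + \<bar>m\<bar> * (b - a)" .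
  next
    fix x d \<sigma> :: real assume x: "x \<in> S" "0 < d" and "\<sigma> = 1 \<or> \<sigma> = -1"
    then consider "\<sigma> = 1" | "\<sigma> = -1" by blast
    then show "\<exists>s t. s \<le> x \<and> x \<le> t \<and> s < t \<and> t - s < d \<and>
        c * (t - s) \<le> \<sigma> * (f t - m * t - (f s - m * s))"
    proof cases
      case 1
      with hi[OF x] show ?thesis by (simp add: pq algebra_simps)
    next
      case 2
      with lo[OF x] show ?thesis by (simp add: pq algebra_simps)
    qed
  qed (use pq assms in auto)
qed

text \<open>Where \<open>differentiable_if_slopes_settle\<close> does not apply, the slopes are
  unbounded or oscillate across some rational pair at every scale. These are one null set and
  countably many others.\<close>

lemma bounded_variation_differentiable_ae:
  fixes f :: "real \<Rightarrow> real"
  assumes var: "\<And>I. nonoverlapping a b I \<Longrightarrow> (\<Sum>k\<in>I. \<bar>f (snd k) - f (fst k)\<bar>) \<le> B"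
  shows "negligible {x\<in>{a<..<b}. \<not> f differentiable at x}"
proof (cases "a < b")
  case False
  then show ?thesis by simp
next
  case True
  \<comment> \<open>The conditions \<open>a \<le> s\<close> and \<open>t \<le> b\<close> keep steep
    intervals where the variation is controlled. At an interior point they exclude no sufficiently
    short interval.\<close>
  define S0 where "S0 = {x\<in>{a<..<b}. \<forall>M d. 0 < M \<longrightarrow> 0 < d \<longrightarrow> (\<exists>s t. a \<le> s \<and> s \<le> x \<and> x \<le> t \<and> t \<le> b \<and>
        s < t \<and> t - s < d \<and> M * (t - s) \<le> \<bar>f t - f s\<bar>)}"
  define S where "S r = {x\<in>{a<..<b}. \<forall>d>0.
      (\<exists>s t. s \<le> x \<and> x \<le> t \<and> s < t \<and> t - s < d \<and> f t - f s \<le> fst r * (t - s)) \<and>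
      (\<exists>s t. s \<le> x \<and> x \<le> t \<and> s < t \<and> t - s < d \<and> snd r * (t - s) \<le> f t - f s)}" for r :: "real \<times> real"
  define R where "R = {r :: real \<times> real. r \<in> \<rat> \<times> \<rat> \<and> fst r < snd r}"
  have "countable R" unfolding R_def by (rule countable_subset[of _ "\<rat> \<times> \<rat>"]) (auto intro: countable_rat)
  have "negligible S0"
    by (rule unbounded_slopes_negligible[where f = f, OF var]) (auto simp: S0_def)
  moreover have "negligible (\<Union>r\<in>R. S r)"
  proof (rule negligible_countable_Union)
    show "countable (S ` R)" using \<open>countable R\<close> by simp
    fix T assume "T \<in> S ` R"
    then obtain r where r: "r \<in> R" "T = S r" by blast
    show "negligible T" unfolding r(2)
      by (rule oscillation_negligible[where f = f and p = "fst r" and q = "snd r", OF var _ True])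
        (use r in \<open>auto simp: R_def S_def\<close>)
  qed
  ultimately have "negligible (S0 \<union> (\<Union>r\<in>R. S r))" by simp
  moreover have "{x\<in>{a<..<b}. \<not> f differentiable at x} \<subseteq> S0 \<union> (\<Union>r\<in>R. S r)"
  proof (intro subsetI, rule ccontr)
    fix x assume x: "x \<in> {x\<in>{a<..<b}. \<not> f differentiable at x}" and no: "x \<notin> S0 \<union> (\<Union>r\<in>R. S r)"
    then have ab: "a < x" "x < b" by auto
    have "x \<notin> S0" using no by blast
    then obtain M d where M: "0 < d" "\<nexists>s t. a \<le> s \<and> s \<le> x \<and> x \<le> t \<and> t \<le> b \<and>
        s < t \<and> t - s < d \<and> M * (t - s) \<le> \<bar>f t - f s\<bar>"
      using ab unfolding S0_def mem_Collect_eq greaterThanLessThan_iff by blast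
    have "a \<le> s \<Longrightarrow> s \<le> x \<Longrightarrow> x \<le> t \<Longrightarrow> t \<le> b \<Longrightarrow> s < t \<Longrightarrow> t - s < d \<Longrightarrow>
        \<bar>f t - f s\<bar> < M * (t - s)" for s t
      using M(2) not_le by blast
    note M = M(1) this
    have "f differentiable at x"
    proof (rule differentiable_if_slopes_settle)
      show "0 < min d (min (x - a) (b - x))" using M ab by simp
      show "\<bar>f t - f s\<bar> \<le> M * (t - s)"
        if "s \<le> x" "x \<le> t" "s < t" "t - s < min d (min (x - a) (b - x))" for s t
        using M(2)[of s t] that by simp
    next
      fix p q :: real assume "p \<in> \<rat>" "q \<in> \<rat>" "p < q"
      then have "x \<notin> S (p, q)" using no by (auto simp: R_def)
      then obtain d where d: "0 < d" "\<not> ((\<exists>s t. s \<le> x \<and> x \<le> t \<and> s < t \<and> t - s < d \<and> f t - f s \<le> p * (t - s)) \<and>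
        (\<exists>s t. s \<le> x \<and> x \<le> t \<and> s < t \<and> t - s < d \<and> q * (t - s) \<le> f t - f s))"
        using ab unfolding S_def by auto
      show "\<exists>d>0. (\<forall>s t. s \<le> x \<longrightarrow> x \<le> t \<longrightarrow> s < t \<longrightarrow> t - s < d \<longrightarrow> p * (t - s) \<le> f t - f s) \<or>
        (\<forall>s t. s \<le> x \<longrightarrow> x \<le> t \<longrightarrow> s < t \<longrightarrow> t - s < d \<longrightarrow> f t - f s \<le> q * (t - s))"
        by (rule exI[of _ d]) (use d in \<open>meson linear\<close>)
    qed
    then show False using x by simp
  qed
  ultimately show ?thesis by (rule negligible_subset)
qed

section \<open>Absolutely continuous functions\<close>

lemma nonoverlapping_sum_length_le_measure:
  assumes I: "nonoverlapping a b I" and U: "U \<in> lmeasurable"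
    and sub: "\<And>k. k \<in> I \<Longrightarrow> {fst k<..<snd k} \<subseteq> U"
  shows "(\<Sum>k\<in>I. snd k - fst k) \<le> measure lebesgue U"
proof -
  note D = nonoverlappingD[OF I]
  have "disjoint_family_on (\<lambda>k. {fst k<..<snd k}) I"
    unfolding disjoint_family_on_def using D(5) by fastforce
  then have "measure lebesgue (\<Union>k\<in>I. {fst k<..<snd k}) = (\<Sum>k\<in>I. measure lebesgue {fst k<..<snd k})"
  proof (intro measure_finite_Union D(1))
    show "emeasure lebesgue {fst k<..<snd k} \<noteq> \<infinity>" if "k \<in> I" for k
      using D(3)[OF that] by simp
  qed auto
  also have "\<dots> = (\<Sum>k\<in>I. snd k - fst k)"
    using D(3) by (intro sum.cong) (auto simp: less_imp_le)
  finally have "measure lebesgue (\<Union>k\<in>I. {fst k<..<snd k}) = (\<Sum>k\<in>I. snd k - fst k)" .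
  moreover have "measure lebesgue (\<Union>k\<in>I. {fst k<..<snd k}) \<le> measure lebesgue U"
    using U D(1) sub by (intro measure_mono_fmeasurable) (auto simp: SUP_le_iff intro!: sets.finite_UN)
  ultimately show ?thesis by simp
qed

lemma absolutely_continuous_nonoverlapping:
  assumes "absolutely_continuous_on_Icc a b f" "0 < e"
  obtains \<delta> where "0 < \<delta>" "\<And>I. nonoverlapping a b I \<Longrightarrow> (\<Sum>k\<in>I. snd k - fst k) < \<delta> \<Longrightarrow>
    (\<Sum>k\<in>I. norm (f (snd k) - f (fst k))) < e"
proof -
  obtain \<delta> where \<delta>: "0 < \<delta>" "\<forall>I :: (real \<times> real) set.
        finite I \<and> (\<forall>(s, t)\<in>I. a \<le> s \<and> s < t \<and> t \<le> b) \<and>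
        pairwise (\<lambda>(s, t) (s', t'). {s<..<t} \<inter> {s'<..<t'} = {}) I \<and>
        (\<Sum>(s, t)\<in>I. t - s) < \<delta> \<longrightarrow> (\<Sum>(s, t)\<in>I. norm (f t - f s)) < e"
    using assms unfolding absolutely_continuous_on_Icc_def by meson
  show ?thesis
  proof
    fix I assume I: "nonoverlapping a b I" "(\<Sum>k\<in>I. snd k - fst k) < \<delta>"
    note D = nonoverlappingD[OF I(1)]
    have "pairwise (\<lambda>(s, t) (s', t'). {s<..<t} \<inter> {s'<..<t'} = {}) I"
      using D(5) unfolding pairwise_def by (fastforce simp: case_prod_beta)
    then show "(\<Sum>k\<in>I. norm (f (snd k) - f (fst k))) < e"
      using \<delta>(2)[rule_format, of I] I D by (simp add: case_prod_beta)
  qed (rule \<delta>(1))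
qed

lemma absolutely_continuous_on_Icc_subset:
  assumes "absolutely_continuous_on_Icc a b f" "a \<le> c" "d \<le> b"
  shows "absolutely_continuous_on_Icc c d f"
  unfolding absolutely_continuous_on_Icc_def
proof (intro allI impI)
  fix e :: real assume "0 < e"
  then obtain \<delta> where \<delta>: "0 < \<delta>" "\<And>I. nonoverlapping a b I \<Longrightarrow> (\<Sum>k\<in>I. snd k - fst k) < \<delta> \<Longrightarrow>
    (\<Sum>k\<in>I. norm (f (snd k) - f (fst k))) < e"
    using absolutely_continuous_nonoverlapping[OF assms(1)] by blast
  show "\<exists>\<delta>>0. \<forall>I :: (real \<times> real) set.
        finite I \<and> (\<forall>(s, t)\<in>I. c \<le> s \<and> s < t \<and> t \<le> d) \<and>
        pairwise (\<lambda>(s, t) (s', t'). {s<..<t} \<inter> {s'<..<t'} = {}) I \<and>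
        (\<Sum>(s, t)\<in>I. t - s) < \<delta> \<longrightarrow> (\<Sum>(s, t)\<in>I. norm (f t - f s)) < e"
  proof (intro exI[of _ \<delta>] conjI allI impI \<delta>(1))
    fix I :: "(real \<times> real) set"
    assume I: "finite I \<and> (\<forall>(s, t)\<in>I. c \<le> s \<and> s < t \<and> t \<le> d) \<and>
        pairwise (\<lambda>(s, t) (s', t'). {s<..<t} \<inter> {s'<..<t'} = {}) I \<and>
        (\<Sum>(s, t)\<in>I. t - s) < \<delta>"
    have "pairwise (\<lambda>k l. snd k \<le> fst l \<or> snd l \<le> fst k) I"
      unfolding pairwise_def
    proof (intro ballI impI)
      fix k l assume kl: "k \<in> I" "l \<in> I" "k \<noteq> l"
      then have "{fst k<..<snd k} \<inter> {fst l<..<snd l} = {}"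
        using I unfolding pairwise_def by (auto simp: case_prod_beta)
      moreover have "fst k < snd k" "fst l < snd l" using I kl by auto
      \<comment> \<open>Otherwise a point between the larger left and the smaller right endpoint
        would lie in both open intervals.\<close>
      ultimately show "snd k \<le> fst l \<or> snd l \<le> fst k"
        using dense[of "max (fst k) (fst l)" "min (snd k) (snd l)"] by fastforce
    qed
    then have "nonoverlapping a b I"
      using I assms(2,3) unfolding nonoverlapping_def by force
    then show "(\<Sum>(s, t)\<in>I. norm (f t - f s)) < e"
      using \<delta>(2)[of I] I by (simp add: case_prod_beta)
  qed
qed

text \<open>Coordinates reduce the claim to real functions, and on short intervals absolute
  continuity yields bounded variation.\<close>

lemma absolutely_continuous_differentiable_ae:
  fixes f :: "real \<Rightarrow> 'a::euclidean_space"
  assumes "absolutely_continuous_on_Icc a b f"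
  shows "negligible {x\<in>{a<..<b}. \<not> f differentiable at x}"
proof -
  obtain \<delta> where \<delta>: "0 < \<delta>" "\<And>I. nonoverlapping a b I \<Longrightarrow> (\<Sum>k\<in>I. snd k - fst k) < \<delta> \<Longrightarrow>
    (\<Sum>k\<in>I. norm (f (snd k) - f (fst k))) < 1"
    using absolutely_continuous_nonoverlapping[OF assms, of 1] by auto
  \<comment> \<open>On intervals shorter than \<open>\<delta>\<close> the variation is at most 1, so no global bound is needed.\<close>
  have local: "negligible {x\<in>{c<..<d}. \<not> f differentiable at x}"
    if cd: "a \<le> c" "c < d" "d \<le> b" "d - c < \<delta>" for c d
  proof -
    have "negligible {x\<in>{c<..<d}. \<not> (\<lambda>x. f x \<bullet> i) differentiable at x}" if i: "i \<in> Basis" for i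
    proof (rule bounded_variation_differentiable_ae)
      fix I assume I: "nonoverlapping c d I"
      then have "(\<Sum>k\<in>I. snd k - fst k) < \<delta>"
        using nonoverlapping_sum_length_le[OF I] cd by simp
      then have "(\<Sum>k\<in>I. norm (f (snd k) - f (fst k))) < 1"
        using \<delta>(2)[OF nonoverlapping_mono[OF I]] cd by simp
      moreover have "(\<Sum>k\<in>I. \<bar>f (snd k) \<bullet> i - f (fst k) \<bullet> i\<bar>) \<le> (\<Sum>k\<in>I. norm (f (snd k) - f (fst k)))"
        using i by (intro sum_mono) (simp add: Basis_le_norm flip: inner_diff_left)
      ultimately show "(\<Sum>k\<in>I. \<bar>f (snd k) \<bullet> i - f (fst k) \<bullet> i\<bar>) \<le> 1" by simp
    qed
    then have "negligible (\<Union>i\<in>Basis. {x\<in>{c<..<d}. \<not> (\<lambda>x. f x \<bullet> i) differentiable at x})"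
      by (intro negligible_Union) auto
    then show ?thesis
      by (rule negligible_subset) (auto simp: differentiable_componentwise_within[of f])
  qed
  show ?thesis
  proof (rule locally_negligible_alt[THEN iffD2], rule ballI)
    fix x assume x: "x \<in> {x\<in>{a<..<b}. \<not> f differentiable at x}"
    \<comment> \<open>A third of \<open>\<delta>\<close> on either side keeps the length below
      \<open>\<delta>\<close>.\<close>
    define c d where "c = max a (x - \<delta> / 3)" and "d = min b (x + \<delta> / 3)"
    have cd: "a \<le> c" "c < x" "x < d" "d \<le> b" "d - c < \<delta>"
      using x \<delta>(1) by (auto simp: c_def d_def)
    show "\<exists>U. openin (top_of_set {x\<in>{a<..<b}. \<not> f differentiable at x}) U \<and> x \<in> U \<and> negligible U"
    proof (intro exI conjI)
      show "openin (top_of_set {x\<in>{a<..<b}. \<not> f differentiable at x})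
          ({x\<in>{a<..<b}. \<not> f differentiable at x} \<inter> {c<..<d})"
        by (intro openin_open_Int open_greaterThanLessThan)
      show "x \<in> {x\<in>{a<..<b}. \<not> f differentiable at x} \<inter> {c<..<d}" using x cd by simp
      show "negligible ({x\<in>{a<..<b}. \<not> f differentiable at x} \<inter> {c<..<d})"
        by (rule negligible_subset[OF local[of c d]]) (use cd in auto)
    qed
  qed
qed

section \<open>The fundamental theorem of calculus for absolutely continuous functions\<close>

text \<open>Translates divisions, which are sets of intervals, into sets of endpoint pairs.
  Degenerate intervals are discarded, and \<open>g x x = 0\<close> ensures that they do not affect
  the sum.\<close>

lemma division_nonoverlapping:
  fixes D :: "real set set"
  assumes D: "D division_of S" and S: "S \<subseteq> {a..b}" and g: "\<And>x. g x x = (0::real)"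
  obtains I where "nonoverlapping a b I" "\<And>k. k \<in> I \<Longrightarrow> {fst k..snd k} \<in> D"
    "(\<Sum>K\<in>D. g (Inf K) (Sup K)) = (\<Sum>k\<in>I. g (fst k) (snd k))"
proof -
  have K: "\<exists>u v. K = {u..v} \<and> u \<le> v \<and> a \<le> u \<and> v \<le> b" if "K \<in> D" for K
  proof -
    obtain u v where "K = {u..v}" using division_ofD(4)[OF D \<open>K \<in> D\<close>] by auto
    moreover have "K \<noteq> {}" "K \<subseteq> {a..b}" using division_ofD(2,3)[OF D \<open>K \<in> D\<close>] S by auto
    ultimately show ?thesis by force
  qed
  then have K': "K = {Inf K..Sup K}" "Inf K \<le> Sup K" "a \<le> Inf K" "Sup K \<le> b" if "K \<in> D" for K
    using that by force+
  define E where "E = {K\<in>D. Inf K < Sup K}"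
  have fin: "finite D" "finite E" using division_ofD(1)[OF D] by (auto simp: E_def)
  let ?h = "\<lambda>K. (Inf K, Sup K) :: real \<times> real"
  have inj: "inj_on ?h E"
    unfolding inj_on_def using K'(1) by (metis (no_types, lifting) E_def Pair_inject mem_Collect_eq)
  show ?thesis
  proof (rule that[of "?h ` E"])
    show "nonoverlapping a b (?h ` E)"
      unfolding nonoverlapping_def
    proof (intro conjI ballI)
      show "finite (?h ` E)" using fin by simp
      show "a \<le> fst k" "fst k < snd k" "snd k \<le> b" if "k \<in> ?h ` E" for k
        using that K'(3,4) by (auto simp: E_def)
      show "pairwise (\<lambda>k l. snd k \<le> fst l \<or> snd l \<le> fst k) (?h ` E)"
        unfolding pairwise_def
      proof (intro ballI impI)
        fix k l assume kl: "k \<in> ?h ` E" "l \<in> ?h ` E" "k \<noteq> l"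
        then obtain K L where KL: "K \<in> E" "L \<in> E" "k = ?h K" "l = ?h L" "K \<noteq> L" by blast
        then have "interior K \<inter> interior L = {}" using division_ofD(5)[OF D] by (auto simp: E_def)
        then have "{Inf K<..<Sup K} \<inter> {Inf L<..<Sup L} = {}"
          using K'(1) KL unfolding E_def by (metis (no_types, lifting) interior_atLeastAtMost_real mem_Collect_eq)
        then show "snd k \<le> fst l \<or> snd l \<le> fst k"
          using dense[of "max (Inf K) (Inf L)" "min (Sup K) (Sup L)"] KL by (fastforce simp: E_def)
      qed
    qed
    show "{fst k..snd k} \<in> D" if "k \<in> ?h ` E" for k
      using that K'(1) by (auto simp: E_def)
    have "(\<Sum>k\<in>?h ` E. g (fst k) (snd k)) = (\<Sum>K\<in>E. g (Inf K) (Sup K))"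
      by (simp add: sum.reindex[OF inj])
    also have "\<dots> = (\<Sum>K\<in>D. g (Inf K) (Sup K))"
      using fin g K'(2) by (intro sum.mono_neutral_left) (force simp: E_def)+
    finally show "(\<Sum>K\<in>D. g (Inf K) (Sup K)) = (\<Sum>k\<in>?h ` E. g (fst k) (snd k))" by simp
  qed
qed

text \<open>The approximation errors to the left and right of \<open>x\<close> are proportional to
  the distances from \<open>x\<close>, and these distances add up to exactly
  \<open>v - u\<close>.\<close>

lemma straddle:
  fixes f :: "real \<Rightarrow> 'a::real_normed_vector"
  assumes "(f has_vector_derivative g) (at x)" "0 < e"
  obtains d where "0 < d" "\<And>u v. u \<le> x \<Longrightarrow> x \<le> v \<Longrightarrow> v - u < d \<Longrightarrow>
    norm ((v - u) *\<^sub>R g - (f v - f u)) \<le> e * (v - u)"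
proof -
  obtain d where d: "0 < d" "\<And>y. norm (y - x) < d \<Longrightarrow> norm (f y - f x - (y - x) *\<^sub>R g) \<le> e * norm (y - x)"
    using assms unfolding has_vector_derivative_def has_derivative_at_alt by blast
  show ?thesis
  proof (rule that[OF d(1)])
    fix u v assume uv: "u \<le> x" "x \<le> v" "v - u < d"
    have "norm ((v - u) *\<^sub>R g - (f v - f u))
        = norm ((f u - f x - (u - x) *\<^sub>R g) - (f v - f x - (v - x) *\<^sub>R g))"
      by (simp add: algebra_simps)
    also have "\<dots> \<le> e * norm (u - x) + e * norm (v - x)"
      by (intro order_trans[OF norm_triangle_ineq4] add_mono d(2)) (use uv in auto)
    also have "\<dots> = e * (v - u)" using uv by (simp add: algebra_simps)
    finally show "norm ((v - u) *\<^sub>R g - (f v - f u)) \<le> e * (v - u)" .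
  qed
qed

text \<open>Gauge integral argument: at points of differentiability the gauge comes from the derivative,
  while the intervals tagged in \<open>N\<close> are forced into an open set of small measure, where absolute
  continuity bounds the increments of \<open>f\<close>.\<close>

theorem absolutely_continuous_has_integral:
  fixes f :: "real \<Rightarrow> 'a::euclidean_space"
  assumes ac: "absolutely_continuous_on_Icc a b f" and "a \<le> b" and N: "negligible N"
    and der: "\<And>x. x \<in> {a..b} - N \<Longrightarrow> (f has_vector_derivative g x) (at x)"
  shows "(g has_integral f b - f a) {a..b}"
proof (cases "a = b")
  case True
  then show ?thesis by (simp add: has_integral_refl)
next
  case False
  then have "a < b" using \<open>a \<le> b\<close> by simp
  \<comment> \<open>With value 0 on \<open>N\<close>, an interval tagged there contributes nothing
    to the Riemann sum, and its error is just the increment of \<open>f\<close>. A change on the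
    null set restores \<open>g\<close> at the end.\<close>
  define h where "h x = (if x \<in> N then 0 else g x)" for x
  have "(h has_integral f b - f a) {a..b}"
    unfolding has_integral_factor_content_real
  proof (intro allI impI)
    fix e :: real assume e: "0 < e"
    obtain \<delta> where \<delta>: "0 < \<delta>" "\<And>I. nonoverlapping a b I \<Longrightarrow> (\<Sum>k\<in>I. snd k - fst k) < \<delta> \<Longrightarrow>
        (\<Sum>k\<in>I. norm (f (snd k) - f (fst k))) < e / 2 * (b - a)"
      using absolutely_continuous_nonoverlapping[OF ac, of "e / 2 * (b - a)"] e \<open>a < b\<close> by auto
    obtain U where U: "open U" "N \<subseteq> U" "U \<in> lmeasurable" "measure lebesgue U < \<delta>"
    proof -
      obtain T where T: "open T" "N \<subseteq> T" "T - N \<in> lmeasurable" "emeasure lebesgue (T - N) < ennreal \<delta>"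
        using sets_lebesgue_outer_open[OF _ \<delta>(1), of N] N negligible_imp_sets by blast
      have "T = (T - N) \<union> N" using T by blast
      then have "T \<in> lmeasurable" "measure lebesgue T = measure lebesgue (T - N)"
        using T N by (metis fmeasurable.Un negligible_imp_measurable,
            metis measure_Un_null_set negligible_iff_null_sets fmeasurableD)
      moreover have "measure lebesgue (T - N) < \<delta>"
        using T \<delta>(1) by (metis emeasure_eq_measure2 ennreal_less_iff measure_nonneg)
      ultimately show ?thesis using that T by simp
    qed
    have "\<exists>d>0. if x \<in> N then ball x d \<subseteq> U else x \<in> {a..b} \<longrightarrow> (\<forall>u v. u \<le> x \<longrightarrow> x \<le> v \<longrightarrow> v - u < d \<longrightarrow>
        norm ((v - u) *\<^sub>R h x - (f v - f u)) \<le> e / 2 * (v - u))" for x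
    proof (cases "x \<in> N")
      case True
      then obtain d where "0 < d" "ball x d \<subseteq> U" using U(1,2) open_contains_ball by blast
      with True show ?thesis by auto
    next
      case False
      show ?thesis
      proof (cases "x \<in> {a..b}")
        case True
        with False have "(f has_vector_derivative h x) (at x)" using der by (simp add: h_def)
        from straddle[OF this, of "e / 2"] obtain d where "0 < d" "\<And>u v. u \<le> x \<Longrightarrow> x \<le> v \<Longrightarrow> v - u < d \<Longrightarrow>
            norm ((v - u) *\<^sub>R h x - (f v - f u)) \<le> e / 2 * (v - u)" using e by auto
        then show ?thesis using False by auto
      qed (use False in \<open>auto intro: exI[of _ 1]\<close>)
    qed
    then obtain d where d: "\<And>x. 0 < d x" "\<And>x. x \<in> N \<Longrightarrow> ball x (d x) \<subseteq> U"
      "\<And>x u v. x \<notin> N \<Longrightarrow> x \<in> {a..b} \<Longrightarrow> u \<le> x \<Longrightarrow> x \<le> v \<Longrightarrow> v - u < d x \<Longrightarrow>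
        norm ((v - u) *\<^sub>R h x - (f v - f u)) \<le> e / 2 * (v - u)" by metis
    show "\<exists>\<gamma>. gauge \<gamma> \<and> (\<forall>p. p tagged_division_of {a..b} \<and> \<gamma> fine p \<longrightarrow>
        norm ((\<Sum>(x, K)\<in>p. measure lborel K *\<^sub>R h x) - (f b - f a)) \<le> e * measure lborel {a..b})"
    proof (intro exI conjI allI impI)
      \<comment> \<open>Half the radius, because an interval inside the ball must be shorter than
        \<open>d x\<close>.\<close>
      show "gauge (\<lambda>x. ball x (d x / 2))" by (intro gauge_ball_dependent) (simp add: d(1))
      fix p assume p: "p tagged_division_of {a..b} \<and> (\<lambda>x. ball x (d x / 2)) fine p"
      note td = tagged_division_ofD[OF conjunct1[OF p]]
      let ?\<Delta> = "\<lambda>K. f (Sup K) - f (Inf K)"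
      have K: "Inf K \<le> x" "x \<le> Sup K" "K = {Inf K..Sup K}" "measure lborel K = Sup K - Inf K"
          "Sup K - Inf K < d x" "K \<subseteq> ball x (d x / 2)" "x \<in> {a..b}" if xK: "(x, K) \<in> p" for x K
      proof -
        obtain u v where uv: "K = {u..v}" using td(4)[OF xK] by auto
        have x: "x \<in> {u..v}" using td(2)[OF xK] uv by simp
        have fine: "K \<subseteq> ball x (d x / 2)" using p xK unfolding fine_def by blast
        have "u \<in> K" "v \<in> K" using uv x by auto
        then have "u \<in> ball x (d x / 2)" "v \<in> ball x (d x / 2)" using fine by blast+
        then have "v - u < d x" unfolding mem_ball dist_real_def by linarith
        then show "Inf K \<le> x" "x \<le> Sup K" "K = {Inf K..Sup K}" "measure lborel K = Sup K - Inf K"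
          "Sup K - Inf K < d x" "K \<subseteq> ball x (d x / 2)" "x \<in> {a..b}"
          using uv x fine td(2,3)[OF xK] by auto
      qed
      define q where "q = {xK\<in>p. fst xK \<in> N}"
      have qp: "q tagged_partial_division_of {a..b}"
      proof (rule tagged_partial_division_subset)
        show "p tagged_partial_division_of {a..b}" using p unfolding tagged_division_of_def by simp
      qed (simp add: q_def)
      note qU = tagged_partial_division_of_Union_self[OF qp]
      have "\<Union>(snd ` q) \<subseteq> {a..b}" using td(3) by (force simp: q_def)
      obtain I where I: "nonoverlapping a b I" "\<And>k. k \<in> I \<Longrightarrow> {fst k..snd k} \<in> snd ` q"
        "(\<Sum>K\<in>snd ` q. norm (f (Sup K) - f (Inf K))) = (\<Sum>k\<in>I. norm (f (snd k) - f (fst k)))"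
        using division_nonoverlapping[OF partial_division_of_tagged_division[OF qp]
            \<open>\<Union>(snd ` q) \<subseteq> {a..b}\<close>, of "\<lambda>s t. norm (f t - f s)"] by auto
      have "(\<Sum>k\<in>I. snd k - fst k) \<le> measure lebesgue U"
      proof (rule nonoverlapping_sum_length_le_measure[OF I(1) U(3)])
        fix k assume "k \<in> I"
        then obtain x where "(x, {fst k..snd k}) \<in> p" "x \<in> N" using I(2) by (force simp: q_def)
        then have "{fst k..snd k} \<subseteq> ball x (d x / 2)" "ball x (d x) \<subseteq> U" using K(6) d(2) by auto
        moreover have "ball x (d x / 2) \<subseteq> ball x (d x)" using d(1)[of x] by (intro subset_ball) simp
        ultimately show "{fst k<..<snd k} \<subseteq> U" by force
      qed
      then have "(\<Sum>K\<in>snd ` q. norm (?\<Delta> K)) \<le> e / 2 * (b - a)"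
        using \<delta>(2)[OF I(1)] I(3) U(4) by simp
      \<comment> \<open>Only a degenerate interval can carry several tags, and its increment is 0,
        so summing over intervals agrees with summing over tagged intervals.\<close>
      moreover have "(\<Sum>(x, K)\<in>q. norm (?\<Delta> K)) = (\<Sum>K\<in>snd ` q. norm (?\<Delta> K))"
      proof -
        \<comment> \<open>The infimum and supremum of the empty set carry no information, so the
          value 0 required for it is built in.\<close>
        let ?d = "\<lambda>K. if K = {} then 0 else norm (?\<Delta> K)"
        have ne: "K \<noteq> {}" if "(x, K) \<in> q" for x K using td(2) that by (auto simp: q_def)
        have "(\<Sum>(x, K)\<in>q. ?d K) = (\<Sum>K\<in>snd ` q. ?d K)"
        proof (rule sum.over_tagged_division_lemma[OF qU])
          fix u v :: real assume "box u v = {}"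
          then consider "v < u" | "u = v" by force
          then show "?d (cbox u v) = 0" by cases auto
        qed
        also have "(\<Sum>(x, K)\<in>q. ?d K) = (\<Sum>(x, K)\<in>q. norm (?\<Delta> K))"
          using ne by (intro sum.cong) auto
        also have "(\<Sum>K\<in>snd ` q. ?d K) = (\<Sum>K\<in>snd ` q. norm (?\<Delta> K))"
          using ne by (intro sum.cong) auto
        finally show ?thesis .
      qed
      ultimately have q: "(\<Sum>(x, K)\<in>q. norm (?\<Delta> K)) \<le> e / 2 * (b - a)" by simp
      have tel: "f b - f a = (\<Sum>(x, K)\<in>p. ?\<Delta> K)" "b - a = (\<Sum>(x, K)\<in>p. Sup K - Inf K)"
        using additive_tagged_division_1[OF \<open>a \<le> b\<close> conjunct1[OF p], of f]
          additive_tagged_division_1[OF \<open>a \<le> b\<close> conjunct1[OF p], of "\<lambda>x. x"] by simp_all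
      have fin: "finite p" using td(1) .
      have "norm ((\<Sum>(x, K)\<in>p. measure lborel K *\<^sub>R h x) - (f b - f a))
          = norm (\<Sum>(x, K)\<in>p. measure lborel K *\<^sub>R h x - ?\<Delta> K)"
        by (simp add: tel(1) case_prod_beta sum_subtractf)
      also have "\<dots> \<le> (\<Sum>(x, K)\<in>p. (if x \<in> N then norm (?\<Delta> K) else 0) + e / 2 * (Sup K - Inf K))"
      proof (intro sum_norm_le, clarify)
        fix x K assume xK: "(x, K) \<in> p"
        note KK = K[OF xK]
        show "norm (measure lborel K *\<^sub>R h x - ?\<Delta> K) \<le> (if x \<in> N then norm (?\<Delta> K) else 0) + e / 2 * (Sup K - Inf K)"
        proof (cases "x \<in> N")
          case True
          have "0 \<le> e / 2 * (Sup K - Inf K)" using KK(1,2) e by simp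
          with True show ?thesis by (simp add: h_def norm_minus_commute)
        next
          case False
          then show ?thesis using d(3)[OF False KK(7,1,2,5)] KK(4) by simp
        qed
      qed
      also have "\<dots> = (\<Sum>(x, K)\<in>p. if x \<in> N then norm (?\<Delta> K) else 0) + e / 2 * (b - a)"
        by (simp add: case_prod_beta sum.distrib tel(2) sum_distrib_left)
      also have "(\<Sum>(x, K)\<in>p. if x \<in> N then norm (?\<Delta> K) else 0) = (\<Sum>(x, K)\<in>q. norm (?\<Delta> K))"
        unfolding q_def case_prod_beta by (rule sum.inter_filter[OF fin, symmetric])
      finally show "norm ((\<Sum>(x, K)\<in>p. measure lborel K *\<^sub>R h x) - (f b - f a)) \<le> e * measure lborel {a..b}"
        using q \<open>a \<le> b\<close> by simp
    qed
  qed
  then show ?thesis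
    by (rule has_integral_spike[OF N, rotated]) (simp add: h_def)
qed


corollary absolutely_continuous_FTC:
  fixes f :: "real \<Rightarrow> 'a::euclidean_space"
  assumes ac: "absolutely_continuous_on_Icc a b f" and st: "a \<le> s" "s \<le> t" "t \<le> b"
  shows "((\<lambda>x. vector_derivative f (at x)) has_integral f t - f s) {s..t}"
proof (rule absolutely_continuous_has_integral)
  \<comment> \<open>The endpoints are exceptional because the two-sided derivative there depends on
    values of \<open>f\<close> outside the interval.\<close>
  let ?N = "{x\<in>{a<..<b}. \<not> f differentiable at x} \<union> {a, b}"
  show "negligible ?N"
    using absolutely_continuous_differentiable_ae[OF ac] by (simp add: negligible_Un)
  fix x assume "x \<in> {s..t} - ?N"
  then have "f differentiable at x" using st by auto
  then show "(f has_vector_derivative vector_derivative f (at x)) (at x)"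
    by (simp add: vector_derivative_works)
qed (use absolutely_continuous_on_Icc_subset[OF ac] st in auto)

text \<open>The gauge integral may converge conditionally, so absolute integrability needs a bound
  on the sums of \<open>norm (integral K ?g)\<close>. By the fundamental theorem these are sums of
  increments of \<open>f\<close>, which are below 1 on intervals shorter than
  \<open>\<delta>\<close>. The bisection principle \<open>Bolzano\<close> then glues short intervals
  together.\<close>

theorem absolutely_continuous_derivative_absolutely_integrable:
  fixes f :: "real \<Rightarrow> 'a::euclidean_space"
  assumes ac: "absolutely_continuous_on_Icc a b f" and "a \<le> b"
  shows "(\<lambda>x. vector_derivative f (at x)) absolutely_integrable_on {a..b}"
proof -
  let ?g = "\<lambda>x. vector_derivative f (at x)"
  obtain \<delta> where \<delta>: "0 < \<delta>" "\<And>I. nonoverlapping a b I \<Longrightarrow> (\<Sum>k\<in>I. snd k - fst k) < \<delta> \<Longrightarrow>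
    (\<Sum>k\<in>I. norm (f (snd k) - f (fst k))) < 1"
    using absolutely_continuous_nonoverlapping[OF ac, of 1] by auto
  have short: "?g absolutely_integrable_on {s..t}" if st: "a \<le> s" "s \<le> t" "t \<le> b" "t - s < \<delta>" for s t
  proof (cases "s = t")
    case True
    then show ?thesis using absolutely_integrable_on_null[of s t ?g] by simp
  next
    case False
    have "?g absolutely_integrable_on cbox s t"
    proof (rule bounded_variation_absolutely_integrable_interval)
      show "?g integrable_on cbox s t"
        using absolutely_continuous_FTC[OF ac st(1-3)] by (auto simp: integrable_on_def)
      fix D assume D: "D division_of cbox s t"
      have "integral K ?g = f (Sup K) - f (Inf K)" if K: "K \<in> D" for K
      proof -
        obtain u v where uv: "K = {u..v}" using division_ofD(4)[OF D K] by auto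
        moreover have "u \<le> v" "s \<le> u" "v \<le> t" using division_ofD(2,3)[OF D K] uv by auto
        ultimately show ?thesis
          using absolutely_continuous_FTC[OF ac, of u v] st by (simp add: integral_unique)
      qed
      moreover obtain I where I: "nonoverlapping s t I"
        "(\<Sum>K\<in>D. norm (f (Sup K) - f (Inf K))) = (\<Sum>k\<in>I. norm (f (snd k) - f (fst k)))"
        by (rule division_nonoverlapping[OF D, of s t "\<lambda>u v. norm (f v - f u)"]) (simp, simp, blast)
      moreover have "(\<Sum>k\<in>I. norm (f (snd k) - f (fst k))) < 1"
        using \<delta>(2)[OF nonoverlapping_mono[OF I(1)]] nonoverlapping_sum_length_le[OF I(1)] st False
        by simp
      ultimately show "(\<Sum>K\<in>D. norm (integral K ?g)) \<le> 1" by simp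
    qed
    then show ?thesis by simp
  qed
  define P where "P s t \<longleftrightarrow> (a \<le> s \<longrightarrow> t \<le> b \<longrightarrow> ?g absolutely_integrable_on {s..t})" for s t
  have "P a b"
  proof (rule Bolzano[OF \<open>a \<le> b\<close>])
    fix s m t assume P: "P s m" "P m t" and le: "s \<le> m" "m \<le> t"
    show "P s t"
      unfolding P_def
    proof (intro impI)
      assume "a \<le> s" "t \<le> b"
      then have "?g absolutely_integrable_on {s..m} \<union> {m..t}"
        using P le unfolding P_def by (intro absolutely_integrable_Un) auto
      then show "?g absolutely_integrable_on {s..t}"
        using le by (simp add: ivl_disj_un_two_touch)
    qed
  next
    fix x assume "a \<le> x" "x \<le> b"
    show "\<exists>d>0. \<forall>s t. s \<le> x \<and> x \<le> t \<and> t - s < d \<longrightarrow> P s t"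
      by (rule exI[of _ \<delta>]) (use short \<delta>(1) in \<open>auto simp: P_def\<close>)
  qed
  then show ?thesis unfolding P_def by simp
qed

section \<open>Hadamard fractional integrals\<close>

text \<open>Prepares the use of Fubini's theorem on the product of \<open>lborel\<close> with
  itself, where Lebesgue measurability of a factor would not be enough.\<close>

lemma completion_ex_borel_measurable_euclidean:
  fixes f :: "'b \<Rightarrow> 'a::euclidean_space"
  assumes "f \<in> borel_measurable (completion M)"
  shows "\<exists>g\<in>borel_measurable M. AE x in M. f x = g x"
proof -
  have "\<exists>g\<in>borel_measurable M. AE x in M. f x \<bullet> i = g x" for i
    by (intro completion_ex_borel_measurable_real borel_measurable_inner borel_measurable_const assms)
  then obtain g where g: "\<And>i. g i \<in> borel_measurable M" "\<And>i. AE x in M. f x \<bullet> i = g i x"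
    by metis
  have "AE x in M. \<forall>i\<in>Basis. f x \<bullet> i = g i x"
    using g(2) by (intro AE_finite_allI) auto
  then have "AE x in M. f x = (\<Sum>i\<in>Basis. g i x *\<^sub>R i)"
    by eventually_elim (metis (no_types, lifting) euclidean_representation sum.cong)
  then show ?thesis
    by (intro bexI[of _ "\<lambda>x. \<Sum>i\<in>Basis. g i x *\<^sub>R i"]) (use g(1) in measurable)
qed

text \<open>For nonnegative functions a gauge integral is automatically absolute; Borel
  measurability then allows the completion to be removed.\<close>

lemma set_integrable_lborel_if_has_integral:
  fixes f :: "real \<Rightarrow> real"
  assumes "(f has_integral I) S" and [measurable]: "f \<in> borel_measurable borel" "S \<in> sets borel"
    and "\<And>x. x \<in> S \<Longrightarrow> 0 \<le> f x"
  shows "set_integrable lborel S f" "(LINT x:S|lborel. f x) = I"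
proof -
  have abs: "set_integrable lebesgue S f"
    using nonnegative_absolutely_integrable_1[of f S] assms by auto
  then have "integrable (completion lborel) (\<lambda>x. indicator S x *\<^sub>R f x)"
    unfolding set_integrable_def .
  then show "set_integrable lborel S f"
    unfolding set_integrable_def by (subst (asm) integrable_completion) measurable
  then show "(LINT x:S|lborel. f x) = I"
    using set_borel_integral_eq_integral(2) assms(1) by (metis integral_unique)
qed

text \<open>Young's inequality for \<open>f\<close> and \<open>g\<close> themselves gives
  integrability of the product. Applied to \<open>f / A\<close> and \<open>g / B\<close>, its two
  terms integrate to \<open>1 / p\<close> and \<open>1 / q\<close>, which add up to 1 and produce
  the sharp bound.\<close>

lemma Holder_inequality:
  fixes f g :: "'b \<Rightarrow> real"
  assumes pq: "1 < p" "1 < q" "1 / p + 1 / q = 1"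
    and [measurable]: "f \<in> borel_measurable M" "g \<in> borel_measurable M"
    and pos: "\<And>x. 0 \<le> f x" "\<And>x. 0 \<le> g x"
    and int: "integrable M (\<lambda>x. f x powr p)" "integrable M (\<lambda>x. g x powr q)"
  shows "integrable M (\<lambda>x. f x * g x)"
    and "(LINT x|M. f x * g x) \<le> (LINT x|M. f x powr p) powr (1 / p) * (LINT x|M. g x powr q) powr (1 / q)"
proof -
  have young: "f x * g x \<le> f x powr p / p + g x powr q / q" for x
    using Youngs_inequality[OF pq pos] .
  show I: "integrable M (\<lambda>x. f x * g x)"
    by (rule Bochner_Integration.integrable_bound[where f = "\<lambda>x. f x powr p / p + g x powr q / q"])
      (use int young pos in \<open>auto intro!: AE_I2 order_trans[OF young abs_ge_self]\<close>)
  define A where "A = (LINT x|M. f x powr p) powr (1 / p)"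
  define B where "B = (LINT x|M. g x powr q) powr (1 / q)"
  have nn: "0 \<le> (LINT x|M. f x powr p)" "0 \<le> (LINT x|M. g x powr q)" by auto
  have AB: "A powr p = (LINT x|M. f x powr p)" "B powr q = (LINT x|M. g x powr q)"
    using nn pq by (auto simp: A_def B_def powr_powr)
  show "(LINT x|M. f x * g x) \<le> (LINT x|M. f x powr p) powr (1 / p) * (LINT x|M. g x powr q) powr (1 / q)"
    unfolding A_def[symmetric] B_def[symmetric]
  \<comment> \<open>The normalisation divides by \<open>A\<close> and \<open>B\<close>. If one of
    them is 0, that factor, and with it the product, vanishes almost everywhere.\<close>
  proof (cases "A = 0 \<or> B = 0")
    case True
    then have "(LINT x|M. f x powr p) = 0 \<or> (LINT x|M. g x powr q) = 0" using AB pq by auto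
    then have "AE x in M. f x * g x = 0"
      using int by (auto simp: integral_nonneg_eq_0_iff_AE elim: AE_mp)
    then have "(LINT x|M. f x * g x) = 0" by (simp add: integral_eq_zero_AE)
    then show "(LINT x|M. f x * g x) \<le> A * B" by (simp add: A_def B_def)
  next
    case False
    then have pos': "0 < A" "0 < B" by (auto simp: A_def B_def)
    have le: "f x * g x \<le> A * B * (f x powr p / (p * A powr p) + g x powr q / (q * B powr q))" for x
    proof -
      have "f x / A * (g x / B) \<le> (f x / A) powr p / p + (g x / B) powr q / q"
        using pos pos' by (intro Youngs_inequality pq) auto
      also have "\<dots> = f x powr p / (p * A powr p) + g x powr q / (q * B powr q)"
        using pos pos' by (simp add: powr_divide mult.commute)
      finally show ?thesis using pos' by (simp add: field_simps)
    qed
    have "(LINT x|M. f x * g x) \<le> (LINT x|M. A * B * (f x powr p / (p * A powr p) + g x powr q / (q * B powr q)))"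
      by (intro integral_mono I le) (use int in auto)
    also have "\<dots> = A * B * (A powr p / (p * A powr p) + B powr q / (q * B powr q))"
      using int AB by simp
    also have "\<dots> = A * B" using pos' pq by simp
    finally show "(LINT x|M. f x * g x) \<le> A * B" .
  qed
qed

section \<open>Logarithmic kernels and inversion of the Hadamard derivative\<close>

text \<open>For \<open>-1 < \<beta>\<close> the antiderivative is continuous up to \<open>t\<close>,
  even if the kernel is unbounded there, so differentiability in the interior suffices.\<close>

lemma has_integral_log_kernel:
  fixes a t \<beta> :: real
  assumes "0 < a" "a < t" "-1 < \<beta>"
  shows "((\<lambda>s. ln (t / s) powr \<beta> / s) has_integral ln (t / a) powr (\<beta> + 1) / (\<beta> + 1)) {a<..<t}"
proof -
  let ?F = "\<lambda>s::real. - (ln (t / s) powr (\<beta> + 1) / (\<beta> + 1))"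
  have "((\<lambda>s. ln (t / s) powr \<beta> / s) has_integral ?F t - ?F a) {a..t}"
  proof (rule fundamental_theorem_of_calculus_interior[where f = ?F])
    have "continuous_on {a..t} (\<lambda>s. ln (t / s) powr (\<beta> + 1))"
      by (intro continuous_on_powr' continuous_intros) (use assms in auto)
    then show "continuous_on {a..t} ?F"
      by (intro continuous_on_minus continuous_on_divide continuous_on_const) (use assms in auto)
    fix s assume s: "s \<in> {a<..<t}"
    then have "0 < ln (t / s)" "0 < s" "0 < t / s" using assms by auto
    then have "((\<lambda>s. ln (t / s)) has_real_derivative - (1 / s)) (at s)"
      using assms by (auto intro!: derivative_eq_intros simp: field_simps power2_eq_square)
    from DERIV_fun_powr[OF this \<open>0 < ln (t / s)\<close>, of "\<beta> + 1"]
    have "((\<lambda>s. ln (t / s) powr (\<beta> + 1)) has_real_derivative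
        (\<beta> + 1) * ln (t / s) powr \<beta> * - (1 / s)) (at s)" by simp
    then have "(?F has_real_derivative - (((\<beta> + 1) * ln (t / s) powr \<beta> * - (1 / s)) / (\<beta> + 1))) (at s)"
      by (intro DERIV_minus DERIV_cdivide)
    moreover have "- (((\<beta> + 1) * ln (t / s) powr \<beta> * - (1 / s)) / (\<beta> + 1)) = ln (t / s) powr \<beta> / s"
      using assms by simp
    ultimately show "(?F has_vector_derivative ln (t / s) powr \<beta> / s) (at s)"
      by (simp only: has_real_derivative_iff_has_vector_derivative)
  qed (use assms in simp)
  then show ?thesis using assms by (simp add: has_integral_Icc_iff_Ioo)
qed

text \<open>That the value is independent of \<open>r\<close> and \<open>t\<close> is what lets a
  double integral with this kernel collapse to a single one.\<close>

lemma has_integral_log_Beta_kernel: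
  fixes r t \<alpha> :: real
  assumes rt: "0 < r" "r < t" and \<alpha>: "0 < \<alpha>" "\<alpha> < 1"
  shows "((\<lambda>s. ln (t / s) powr (\<alpha> - 1) * ln (s / r) powr (- \<alpha>) / s) has_integral
    Gamma \<alpha> * Gamma (1 - \<alpha>)) {r<..<t}"
proof -
  define L where "L = ln (t / r)"
  have L: "0 < L" using rt unfolding L_def by (intro ln_gt_zero) simp
  \<comment> \<open>the substitution \<open>s = r (t/r)\<^sup>x\<close>, which turns the integral into the Beta integral\<close>
  define g where "g x = r * exp (L * x)" for x
  let ?f = "\<lambda>s. ln (t / s) powr (\<alpha> - 1) * ln (s / r) powr (- \<alpha>) / s"
  have t: "t = r * exp L" using rt by (simp add: L_def)
  have g_pos: "0 < g x" for x using rt by (simp add: g_def)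
  have eq: "\<bar>g x * L\<bar> * ?f (g x) = x powr (1 - \<alpha> - 1) * (1 - x) powr (\<alpha> - 1)" if x: "x \<in> {0<..<1}" for x
  proof -
    have "t / g x = exp (L * (1 - x))" "g x / r = exp (L * x)"
      using rt by (simp_all add: t g_def right_diff_distrib exp_diff)
    then have "?f (g x) = (L * (1 - x)) powr (\<alpha> - 1) * (L * x) powr (- \<alpha>) / g x" by simp
    also have "\<dots> = L powr (\<alpha> - 1) * L powr (- \<alpha>) * ((1 - x) powr (\<alpha> - 1) * x powr (- \<alpha>)) / g x"
      using x L by (simp add: powr_mult)
    \<comment> \<open>The exponents add up to -1, so the powers of \<open>L\<close> cancel against
      the Jacobian \<open>g x * L\<close>, and with them the dependence on \<open>r\<close> and
      \<open>t\<close>.\<close>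
    also have "L powr (\<alpha> - 1) * L powr (- \<alpha>) = 1 / L"
      by (subst powr_add[symmetric]) (use L in \<open>simp add: powr_minus_divide\<close>)
    finally show ?thesis using g_pos[of x] L by (simp add: abs_mult)
  qed
  have "((\<lambda>x. x powr (1 - \<alpha> - 1) * (1 - x) powr (\<alpha> - 1)) has_integral Beta (1 - \<alpha>) \<alpha>) {0<..<1}"
    using has_integral_Beta_real[of "1 - \<alpha>" \<alpha>] \<alpha> by (simp add: has_integral_Icc_iff_Ioo)
  also have "Beta (1 - \<alpha>) \<alpha> = Gamma \<alpha> * Gamma (1 - \<alpha>)" by (simp add: Beta_def)
  finally have I: "((\<lambda>x. \<bar>g x * L\<bar> * ?f (g x)) has_integral Gamma \<alpha> * Gamma (1 - \<alpha>)) {0<..<1}"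
    by (rule has_integral_eq[rotated]) (rule eq[symmetric])
  have img: "g ` {0<..<1} = {r<..<t}"
  proof
    show "g ` {0<..<1} \<subseteq> {r<..<t}" using rt L by (auto simp: g_def t)
    show "{r<..<t} \<subseteq> g ` {0<..<1}"
    proof
      fix s assume s: "s \<in> {r<..<t}"
      then have "s = g (ln (s / r) / L)" using rt L by (simp add: g_def)
      moreover have "ln (s / r) < L" "0 < ln (s / r)" using s rt by (auto simp: L_def divide_strict_right_mono)
      ultimately show "s \<in> g ` {0<..<1}" using L by (intro image_eqI[of _ _ "ln (s / r) / L"]) auto
    qed
  qed
  have "(\<lambda>x. \<bar>g x * L\<bar> * ?f (g x)) absolutely_integrable_on {0<..<1} \<and>
      integral {0<..<1} (\<lambda>x. \<bar>g x * L\<bar> * ?f (g x)) = Gamma \<alpha> * Gamma (1 - \<alpha>)"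
    using I g_pos L by (auto simp: integral_unique integrable_on_def
        intro!: nonnegative_absolutely_integrable_1 mult_nonneg_nonneg divide_nonneg_pos)
  moreover have "(g has_field_derivative g x * L) (at x within {0<..<1})" for x
    unfolding g_def by (auto intro!: derivative_eq_intros)
  moreover have "inj_on g {0<..<1}" using rt L by (auto simp: inj_on_def g_def)
  ultimately have "?f absolutely_integrable_on {r<..<t} \<and> integral {r<..<t} ?f = Gamma \<alpha> * Gamma (1 - \<alpha>)"
    using has_absolute_integral_change_of_variables_1'[of "{0<..<1}" g "\<lambda>x. g x * L" ?f
        "Gamma \<alpha> * Gamma (1 - \<alpha>)"] img by simp
  then show ?thesis
    by (auto simp: has_integral_iff dest: set_lebesgue_integral_eq_integral(1))
qed


text \<open>Over the triangle \<open>a < r < s < t\<close>, integrating in \<open>s\<close> first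
  leaves a Beta constant times \<open>g r\<close>. Integrability of the outer integrand is a
  conclusion of Fubini's theorem, as the integral \<open>J s\<close> is only known to converge for
  almost every \<open>s\<close>.\<close>

lemma log_kernel_Fubini:
  fixes g :: "real \<Rightarrow> 'a::euclidean_space"
  assumes at: "0 < a" and \<alpha>: "0 < \<alpha>" "\<alpha> < 1"
    and [measurable]: "g \<in> borel_measurable borel" and g: "set_integrable lborel {a<..<t} g"
  defines "J \<equiv> \<lambda>s. LINT r:{a<..<s}|lborel. (ln (s / r) powr (- \<alpha>)) *\<^sub>R g r"
  shows "set_integrable lborel {a<..<t} (\<lambda>s. (ln (t / s) powr (\<alpha> - 1) / s) *\<^sub>R J s)"
    and "(LINT s:{a<..<t}|lborel. (ln (t / s) powr (\<alpha> - 1) / s) *\<^sub>R J s)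
      = (Gamma \<alpha> * Gamma (1 - \<alpha>)) *\<^sub>R (LINT r:{a<..<t}|lborel. g r)"
proof -
  define B where "B = Gamma \<alpha> * Gamma (1 - \<alpha>)"
  define k where "k r s = ln (t / s) powr (\<alpha> - 1) * ln (s / r) powr (- \<alpha>) / s" for r s
  \<comment> \<open>Extension by 0 off the triangle makes both iterated integrals run over the whole
    line.\<close>
  define c where "c r s = (if a < r \<and> r < s \<and> s < t then k r s else 0)" for r s
  have [measurable]: "(\<lambda>x. c (fst x) (snd x)) \<in> borel_measurable (borel \<Otimes>\<^sub>M borel)"
    unfolding c_def k_def by measurable
  have c_nonneg: "0 \<le> c r s" for r s
    using at by (auto simp: c_def k_def)
  have c_eq: "c r s = (if r \<in> {a<..<t} then indicator {r<..<t} s * k r s else 0)" for r s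
    by (auto simp: c_def)
  have c: "integrable lborel (c r)" "(LINT s|lborel. c r s) = (if r \<in> {a<..<t} then B else 0)" for r
  proof -
    have "integrable lborel (c r) \<and> (LINT s|lborel. c r s) = (if r \<in> {a<..<t} then B else 0)"
    proof (cases "r \<in> {a<..<t}")
      case True
      then have r: "0 < r" "r < t" using at by auto
      have "set_integrable lborel {r<..<t} (k r)" "(LINT s:{r<..<t}|lborel. k r s) = B"
      proof -
        have "(k r has_integral B) {r<..<t}"
          using has_integral_log_Beta_kernel[OF r \<alpha>] by (simp add: k_def[abs_def] B_def)
        moreover have "k r \<in> borel_measurable borel" unfolding k_def[abs_def] by measurable
        moreover have "0 \<le> k r s" if "s \<in> {r<..<t}" for s using that r by (simp add: k_def)
        ultimately show "set_integrable lborel {r<..<t} (k r)" "(LINT s:{r<..<t}|lborel. k r s) = B"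
          using set_integrable_lborel_if_has_integral[of "k r" B "{r<..<t}"] by auto
      qed
      then show ?thesis
        using True by (simp add: set_integrable_def set_lebesgue_integral_def c_eq[abs_def])
    next
      case False
      then have "c r = (\<lambda>_. 0)" by (auto simp: c_def fun_eq_iff)
      then show ?thesis using False by auto
    qed
    then show "integrable lborel (c r)" "(LINT s|lborel. c r s) = (if r \<in> {a<..<t} then B else 0)"
      by auto
  qed
  let ?F = "\<lambda>(r, s). c r s *\<^sub>R g r"
  have F: "integrable (lborel \<Otimes>\<^sub>M lborel) ?F"
  proof (rule lborel_pair.Fubini_integrable)
    show "?F \<in> borel_measurable (lborel \<Otimes>\<^sub>M lborel)" by (simp add: case_prod_beta)
    \<comment> \<open>The kernel is nonnegative, so integrating the norm in \<open>s\<close> merely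
      multiplies \<open>norm (g r)\<close> by \<open>B\<close>. The absolute integrability that
      Fubini requires is thus that of \<open>g\<close>.\<close>
    have norm: "(LINT s|lborel. norm (?F (r, s))) = B * norm (indicator {a<..<t} r *\<^sub>R g r)" for r
      using c(2)[of r] by (simp add: c_nonneg)
    show "integrable lborel (\<lambda>r. LINT s|lborel. norm (?F (r, s)))"
      unfolding norm using g[unfolded set_integrable_def]
      by (intro integrable_mult_right integrable_norm)
    show "AE r in lborel. integrable lborel (\<lambda>s. ?F (r, s))"
      using c(1) by simp
  qed
  have inner: "(LINT r|lborel. c r s *\<^sub>R g r)
      = indicator {a<..<t} s *\<^sub>R (ln (t / s) powr (\<alpha> - 1) / s) *\<^sub>R J s" for s
  proof -
    have "(LINT r|lborel. c r s *\<^sub>R g r)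
        = (LINT r|lborel. (indicator {a<..<t} s * (ln (t / s) powr (\<alpha> - 1) / s)) *\<^sub>R
          (indicator {a<..<s} r *\<^sub>R (ln (s / r) powr (- \<alpha>)) *\<^sub>R g r))"
      by (intro Bochner_Integration.integral_cong refl) (auto simp: c_def k_def indicator_def)
    also have "\<dots> = (indicator {a<..<t} s * (ln (t / s) powr (\<alpha> - 1) / s)) *\<^sub>R J s"
      unfolding J_def set_lebesgue_integral_def by (rule integral_scaleR_right)
    finally show ?thesis by simp
  qed
  show "set_integrable lborel {a<..<t} (\<lambda>s. (ln (t / s) powr (\<alpha> - 1) / s) *\<^sub>R J s)"
    using lborel_pair.integrable_snd[OF F] unfolding set_integrable_def inner .
  have "(LINT s:{a<..<t}|lborel. (ln (t / s) powr (\<alpha> - 1) / s) *\<^sub>R J s)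
      = (LINT r|lborel. LINT s|lborel. c r s *\<^sub>R g r)"
    using lborel_pair.integral_snd[OF F] lborel_pair.integral_fst[OF F]
    unfolding set_lebesgue_integral_def inner by simp
  also have "\<dots> = (LINT r|lborel. B *\<^sub>R (indicator {a<..<t} r *\<^sub>R g r))"
    using c by (intro Bochner_Integration.integral_cong) auto
  also have "\<dots> = B *\<^sub>R (LINT r:{a<..<t}|lborel. g r)"
    unfolding set_lebesgue_integral_def by (rule integral_scaleR_right)
  finally show "(LINT s:{a<..<t}|lborel. (ln (t / s) powr (\<alpha> - 1) / s) *\<^sub>R J s)
      = (Gamma \<alpha> * Gamma (1 - \<alpha>)) *\<^sub>R (LINT r:{a<..<t}|lborel. g r)"
    by (simp add: B_def)
qed


text \<open>Inversion by the Hadamard integral, followed by the triangle inequality. For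
  \<open>\<alpha> = 1\<close> the kernel is 1 and the weight \<open>1 / s\<close> cancels the factor
  \<open>s\<close> of the derivative. For smaller \<open>\<alpha>\<close> the Fubini lemma is
  applied to a Borel version of the derivative of \<open>u\<close>.\<close>

lemma norm_le_hadamard_integral:
  fixes u :: "real \<Rightarrow> 'a::euclidean_space"
  assumes a: "0 < a" and \<alpha>: "0 < \<alpha>" "\<alpha> \<le> 1"
    and ac: "absolutely_continuous_on_Icc a b u" and ua: "u a = 0" and t: "a < t" "t \<le> b"
  shows "set_integrable lebesgue {a<..<t} (\<lambda>s. ln (t / s) powr (\<alpha> - 1) * norm (hadamard_deriv \<alpha> a u s) / s)"
    (is ?int)
    and "Gamma \<alpha> * norm (u t) \<le>
      (LINT s:{a<..<t}|lebesgue. ln (t / s) powr (\<alpha> - 1) * norm (hadamard_deriv \<alpha> a u s) / s)"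
    (is ?le)
proof -
  let ?v = "\<lambda>x. vector_derivative u (at x)"
  have "?v absolutely_integrable_on {a..b}"
    using absolutely_continuous_derivative_absolutely_integrable[OF ac] t by simp
  then have v: "set_integrable lebesgue {a<..<t} ?v"
    using t by (auto intro: set_integrable_subset)
  have ut: "u t = (LINT s:{a<..<t}|lebesgue. ?v s)"
  proof -
    have "(?v has_integral u t) {a<..<t}"
      using absolutely_continuous_FTC[OF ac, of a t] t ua by (simp add: has_integral_Icc_iff_Ioo)
    then show ?thesis
      using set_lebesgue_integral_eq_integral(2)[OF v] by (simp add: integral_unique)
  qed
  have "?int \<and> ?le"
  proof (cases "\<alpha> = 1")
    case True
    have eq: "ln (t / s) powr (\<alpha> - 1) * norm (hadamard_deriv \<alpha> a u s) / s = norm (?v s)"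
      if "s \<in> {a<..<t}" for s
    proof -
      \<comment> \<open>Positivity matters even for exponent 0, since
        \<open>0 powr 0 = 0\<close>.\<close>
      have "0 < ln (t / s)" using that a by (intro ln_gt_zero) auto
      then show ?thesis using that a by (simp add: True hadamard_deriv_def)
    qed
    have "set_integrable lebesgue {a<..<t} (\<lambda>s. norm (?v s))"
      using v by (rule set_integrable_norm)
    moreover have "?int = set_integrable lebesgue {a<..<t} (\<lambda>s. norm (?v s))"
      by (intro set_integrable_cong refl eq)
    ultimately have int: ?int by simp
    have "norm (u t) \<le> (LINT s:{a<..<t}|lebesgue. norm (?v s))"
      unfolding ut by (rule set_integral_norm_bound[OF v])
    moreover have "(LINT s:{a<..<t}|lebesgue. norm (?v s)) =
        (LINT s:{a<..<t}|lebesgue. ln (t / s) powr (\<alpha> - 1) * norm (hadamard_deriv \<alpha> a u s) / s)"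
      by (intro set_lebesgue_integral_cong allI impI eq[symmetric]) auto
    ultimately have ?le by (simp add: True)
    with int show ?thesis ..
  next
    case False
    then have \<alpha>1: "\<alpha> < 1" using \<alpha> by simp
    obtain g where g [measurable]: "g \<in> borel_measurable borel"
      and ae: "AE x in lborel. indicator {a<..<t} x *\<^sub>R ?v x = g x"
      using completion_ex_borel_measurable_euclidean[of "\<lambda>x. indicator {a<..<t} x *\<^sub>R ?v x" lborel]
        borel_measurable_integrable[OF v[unfolded set_integrable_def]] by auto
    have ae': "AE x in lebesgue. indicator {a<..<t} x *\<^sub>R ?v x = g x"
      using ae by (rule AE_completion)
    \<comment> \<open>\<open>hadamard_deriv\<close> integrates over \<open>lebesgue\<close>, the
      Fubini lemma over \<open>lborel\<close>. The Borel version \<open>g\<close> connects the two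
      on every subinterval starting at \<open>a\<close>.\<close>
    have transfer: "(LINT s:{a<..<r}|lebesgue. f s *\<^sub>R ?v s) = (LINT s:{a<..<r}|lborel. f s *\<^sub>R g s)"
      if r: "r \<le> t" and f [measurable]: "f \<in> borel_measurable borel" for r and f :: "real \<Rightarrow> real"
    proof -
      have v_meas: "(\<lambda>x. indicator {a<..<t} x *\<^sub>R ?v x) \<in> borel_measurable lebesgue"
        using v unfolding set_integrable_def by (rule borel_measurable_integrable)
      have f_meas: "f \<in> borel_measurable lebesgue"
        using f by (auto intro: measurable_completion)
      have eq: "indicator {a<..<r} s *\<^sub>R f s *\<^sub>R ?v s
          = indicator {a<..<r} s *\<^sub>R f s *\<^sub>R (indicator {a<..<t} s *\<^sub>R ?v s)" for s
        using r by (auto simp: indicator_def)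
      have "(LINT s|lebesgue. indicator {a<..<r} s *\<^sub>R f s *\<^sub>R (indicator {a<..<t} s *\<^sub>R ?v s))
          = (LINT s|lebesgue. indicator {a<..<r} s *\<^sub>R f s *\<^sub>R g s)"
      proof (rule integral_cong_AE)
        show "(\<lambda>s. indicator {a<..<r} s *\<^sub>R f s *\<^sub>R (indicator {a<..<t} s *\<^sub>R ?v s)) \<in> borel_measurable lebesgue"
          by (intro borel_measurable_scaleR[OF _ borel_measurable_scaleR[OF f_meas v_meas]]
              borel_measurable_indicator) simp
        show "AE s in lebesgue. indicator {a<..<r} s *\<^sub>R f s *\<^sub>R (indicator {a<..<t} s *\<^sub>R ?v s)
            = indicator {a<..<r} s *\<^sub>R f s *\<^sub>R g s"
          using ae' by eventually_elim simp
        show "(\<lambda>s. indicator {a<..<r} s *\<^sub>R f s *\<^sub>R g s) \<in> borel_measurable lebesgue"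
          by (rule measurable_completion) measurable
      qed
      also have "\<dots> = (LINT s|lborel. indicator {a<..<r} s *\<^sub>R f s *\<^sub>R g s)"
        by (rule integral_completion) measurable
      finally show ?thesis unfolding set_lebesgue_integral_def eq .
    qed
    have g_int: "set_integrable lborel {a<..<t} g"
    proof -
      have "integrable lebesgue g"
      proof (rule integrable_cong_AE_imp)
        show "integrable lebesgue (\<lambda>x. indicator {a<..<t} x *\<^sub>R ?v x)"
          using v unfolding set_integrable_def .
        show "g \<in> borel_measurable lebesgue" by (rule measurable_completion) measurable
      qed (rule ae')
      then have "integrable lborel g" by (simp add: integrable_completion)
      then show ?thesis unfolding set_integrable_def by (intro integrable_mult_indicator) auto
    qed
    define J where "J s = (LINT r:{a<..<s}|lborel. (ln (s / r) powr (- \<alpha>)) *\<^sub>R g r)" for s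
    have G: "0 < Gamma \<alpha>" "0 < Gamma (1 - \<alpha>)" using \<alpha> \<alpha>1 by auto
    have D: "hadamard_deriv \<alpha> a u s = (1 / Gamma (1 - \<alpha>)) *\<^sub>R J s" if s: "s \<in> {a<..<t}" for s
    proof -
      have "(LINT r:{a<..<s}|lebesgue. (ln (s / r) powr (- \<alpha>) / r) *\<^sub>R (r *\<^sub>R ?v r))
          = (LINT r:{a<..<s}|lebesgue. (ln (s / r) powr (- \<alpha>)) *\<^sub>R ?v r)"
        using a by (intro set_lebesgue_integral_cong) auto
      also have "\<dots> = J s" unfolding J_def by (rule transfer) (use s in auto)
      finally show ?thesis using False by (simp add: hadamard_deriv_def)
    qed
    note F = log_kernel_Fubini[OF a \<alpha>(1) \<alpha>1 g g_int, folded J_def]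
    let ?h = "\<lambda>s. (ln (t / s) powr (\<alpha> - 1) / s) *\<^sub>R J s"
    have eq: "ln (t / s) powr (\<alpha> - 1) * norm (hadamard_deriv \<alpha> a u s) / s = norm (?h s) / Gamma (1 - \<alpha>)"
      if "s \<in> {a<..<t}" for s
      using that a G by (simp add: D)
    have nh: "set_integrable lborel {a<..<t} (\<lambda>s. norm (?h s))"
      by (rule set_integrable_norm[OF F(1)])
    have h_meas: "(\<lambda>s. indicator {a<..<t} s *\<^sub>R norm (?h s)) \<in> borel_measurable lborel"
      using nh unfolding set_integrable_def by (rule borel_measurable_integrable)
    have "set_integrable lebesgue {a<..<t} (\<lambda>s. norm (?h s))"
      using nh unfolding set_integrable_def by (subst integrable_completion[OF h_meas])
    then have "set_integrable lebesgue {a<..<t} (\<lambda>s. norm (?h s) / Gamma (1 - \<alpha>))"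
      by (rule set_integrable_divide)
    moreover have "?int = set_integrable lebesgue {a<..<t} (\<lambda>s. norm (?h s) / Gamma (1 - \<alpha>))"
      by (intro set_integrable_cong refl eq)
    ultimately have int: ?int by simp
    have "u t = (LINT s:{a<..<t}|lborel. g s)"
      unfolding ut using transfer[of t "\<lambda>_. 1"] by simp
    \<comment> \<open>The normalising factor of the derivative is kept on both sides and cancelled
      at the end.\<close>
    then have "Gamma (1 - \<alpha>) * (Gamma \<alpha> * norm (u t)) = norm (LINT s:{a<..<t}|lborel. ?h s)"
      using G F(2) by (simp add: abs_mult)
    also have "\<dots> \<le> (LINT s:{a<..<t}|lborel. norm (?h s))"
      by (rule set_integral_norm_bound[OF F(1)])
    also have "\<dots> = (LINT s:{a<..<t}|lebesgue. norm (?h s))"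
      unfolding set_lebesgue_integral_def by (rule integral_completion[OF h_meas, symmetric])
    also have "\<dots> = Gamma (1 - \<alpha>) * (LINT s:{a<..<t}|lebesgue. norm (?h s) / Gamma (1 - \<alpha>))"
      by (subst set_integral_divide_zero) (use G in simp)
    also have "(LINT s:{a<..<t}|lebesgue. norm (?h s) / Gamma (1 - \<alpha>))
        = (LINT s:{a<..<t}|lebesgue. ln (t / s) powr (\<alpha> - 1) * norm (hadamard_deriv \<alpha> a u s) / s)"
      by (intro set_lebesgue_integral_cong allI impI eq[symmetric]) auto
    finally show ?thesis using G int by simp
  qed
  then show ?int ?le by simp_all
qed

section \<open>The Hoelder estimate and the weighted inequality\<close>

text \<open>Hoelder's inequality for \<open>ds/s\<close> is obtained from the one for Lebesgue
  measure by splitting \<open>1 / s\<close> into \<open>s powr (- 1 / p)\<close> and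
  \<open>s powr (- 1 / q)\<close>, one for each factor.\<close>

lemma norm_le_hadamard_norm:
  fixes u :: "real \<Rightarrow> 'a::euclidean_space"
  assumes a: "0 < a" and p: "1 < p" and \<alpha>: "1 / p < \<alpha>" "\<alpha> \<le> 1"
    and ac: "absolutely_continuous_on_Icc a b u" and ua: "u a = 0" and t: "a < t" "t < b"
    and Lp: "in_weighted_Lp p (\<lambda>x. 1 / x) a b (hadamard_deriv \<alpha> a u)"
  shows "norm (u t) \<le> ln (b / a) powr (\<alpha> - 1 / p) /
      ((\<alpha> * p / (p - 1) - 1 / (p - 1)) powr ((p - 1) / p) * Gamma \<alpha>)
      * weighted_Lp_norm p (\<lambda>x. 1 / x) a b (hadamard_deriv \<alpha> a u)"
proof -
  define q where "q = p / (p - 1)"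
  \<comment> \<open>This equals \<open>(\<alpha> - 1) * q + 1\<close>, the exponent that arises when
    the \<open>q\<close>-th power of the kernel is integrated; \<open>1 / p < \<alpha>\<close> makes
    it positive.\<close>
  define \<kappa> where "\<kappa> = \<alpha> * p / (p - 1) - 1 / (p - 1)"
  let ?D = "hadamard_deriv \<alpha> a u"
  let ?N = "LINT x:{a<..<b}|lebesgue. norm (?D x) powr p * (1 / x)"
  have pq: "1 < q" "1 / p + 1 / q = 1" "1 / q = (p - 1) / p"
    using p by (auto simp: q_def field_simps)
  have "0 < \<alpha>" using \<alpha> p by (smt (verit) divide_pos_pos)
  have "1 < \<alpha> * p" using \<alpha> p by (simp add: field_simps)
  have \<kappa>_eq: "\<kappa> = (\<alpha> * p - 1) / (p - 1)" by (simp add: \<kappa>_def diff_divide_distrib)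
  have \<kappa>: "0 < \<kappa>" "\<kappa> = (\<alpha> - 1) * q + 1" "\<kappa> * (1 / q) = \<alpha> - 1 / p"
  proof -
    show "0 < \<kappa>" using \<open>1 < \<alpha> * p\<close> p by (simp add: \<kappa>_eq)
    have "(\<alpha> - 1) * q + 1 = ((\<alpha> - 1) * p + (p - 1)) / (p - 1)"
      using p by (simp add: q_def add_divide_distrib)
    then show "\<kappa> = (\<alpha> - 1) * q + 1" by (simp add: \<kappa>_eq algebra_simps)
    have "\<kappa> * (1 / q) = (\<alpha> * p - 1) / p" unfolding \<kappa>_eq pq(3) using p by simp
    also have "\<dots> = \<alpha> - 1 / p" using p by (simp add: diff_divide_distrib)
    finally show "\<kappa> * (1 / q) = \<alpha> - 1 / p" .
  qed
  have D_meas: "(\<lambda>x. indicator {a<..<b} x *\<^sub>R ?D x) \<in> borel_measurable lebesgue"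
    and D_int: "integrable lebesgue (\<lambda>x. indicator {a<..<b} x * (norm (?D x) powr p * (1 / x)))"
    using Lp by (auto simp: in_weighted_Lp_def set_borel_measurable_def set_integrable_def)
  define f where "f s = indicator {a<..<t} s * (norm (?D s) * s powr (- 1 / p))" for s
  define g where "g s = indicator {a<..<t} s * (ln (t / s) powr (\<alpha> - 1) * s powr (- 1 / q))" for s
  \<comment> \<open>Measurability is given only for the derivative cut off to
    \<open>{a<..<b}\<close>, so \<open>f\<close> is expressed through that.\<close>
  have f_eq: "f s = indicator {a<..<t} s * (norm (indicator {a<..<b} s *\<^sub>R ?D s) * s powr (- 1 / p))" for s
    using t by (auto simp: f_def indicator_def)
  have [measurable]: "f \<in> borel_measurable lebesgue"
  proof -
    have m1: "(\<lambda>s. norm (indicator {a<..<b} s *\<^sub>R ?D s)) \<in> borel_measurable lebesgue"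
      by (rule measurable_compose[OF D_meas borel_measurable_norm])
    have m2: "(\<lambda>s. s powr (- 1 / p)) \<in> borel_measurable lebesgue"
      by (rule measurable_completion) measurable
    show ?thesis
      unfolding f_eq[abs_def]
      by (rule borel_measurable_times[OF borel_measurable_indicator borel_measurable_times[OF m1 m2]]) simp
  qed
  have [measurable]: "g \<in> borel_measurable lebesgue"
    unfolding g_def[abs_def] by (rule measurable_completion) measurable
  have fp: "f s powr p = indicator {a<..<t} s * (norm (?D s) powr p * (1 / s))" for s
    using a p by (auto simp: f_def indicator_def powr_mult powr_divide powr_powr powr_minus_divide)
  have gq: "g s powr q = indicator {a<..<t} s *\<^sub>R (ln (t / s) powr ((\<alpha> - 1) * q) / s)" for s
    using a pq(1) by (auto simp: g_def indicator_def powr_mult powr_divide powr_powr powr_minus_divide)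
  have fg: "f s * g s = indicator {a<..<t} s *\<^sub>R (ln (t / s) powr (\<alpha> - 1) * norm (?D s) / s)" for s
  proof (cases "s \<in> {a<..<t}")
    case True
    then have "s powr (- 1 / p) * s powr (- 1 / q) = s powr (- (1 / p + 1 / q))"
      by (simp add: powr_add[symmetric])
    also have "\<dots> = 1 / s" using True a pq by (simp add: powr_minus_divide)
    finally have "s powr (- 1 / p) * s powr (- 1 / q) = 1 / s" .
    moreover have "f s * g s = ln (t / s) powr (\<alpha> - 1) * norm (?D s) * (s powr (- 1 / p) * s powr (- 1 / q))"
      using True by (simp add: f_def g_def)
    ultimately show ?thesis using True by simp
  qed (simp add: f_def)
  have f_int: "integrable lebesgue (\<lambda>s. f s powr p)"
  proof (rule Bochner_Integration.integrable_bound[OF D_int])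
    show "AE s in lebesgue. norm (f s powr p) \<le> norm (indicator {a<..<b} s * (norm (?D s) powr p * (1 / s)))"
      unfolding fp using t by (intro AE_I2) (auto simp: indicator_def)
  qed measurable
  have f_le: "(LINT s|lebesgue. f s powr p) \<le> ?N"
    unfolding set_lebesgue_integral_def real_scaleR_def
    by (intro integral_mono f_int D_int) (use t a in \<open>auto simp: fp indicator_def\<close>)
  have log: "((\<lambda>s. ln (t / s) powr ((\<alpha> - 1) * q) / s) has_integral ln (t / a) powr \<kappa> / \<kappa>) {a<..<t}"
    using has_integral_log_kernel[OF a t(1), of "(\<alpha> - 1) * q"] \<kappa> by simp
  have log_int: "set_integrable lebesgue {a<..<t} (\<lambda>s. ln (t / s) powr ((\<alpha> - 1) * q) / s)"
    by (rule nonnegative_absolutely_integrable_1) (use log a in auto)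
  then have g_int: "integrable lebesgue (\<lambda>s. g s powr q)"
    unfolding gq set_integrable_def .
  have g_eq: "(LINT s|lebesgue. g s powr q) = ln (t / a) powr \<kappa> / \<kappa>"
    using set_lebesgue_integral_eq_integral(2)[OF log_int] integral_unique[OF log]
    unfolding gq set_lebesgue_integral_def by simp
  have G: "0 < Gamma \<alpha>" using \<open>0 < \<alpha>\<close> by simp
  have la: "0 < ln (t / a)" "ln (t / a) \<le> ln (b / a)" using a t by (auto simp: divide_right_mono)
  have "Gamma \<alpha> * norm (u t) \<le> (LINT s|lebesgue. f s * g s)"
    using norm_le_hadamard_integral(2)[OF a \<open>0 < \<alpha>\<close> \<alpha>(2) ac ua t(1)] t(2)
    by (simp add: fg set_lebesgue_integral_def)
  also have "\<dots> \<le> (LINT s|lebesgue. f s powr p) powr (1 / p) * (LINT s|lebesgue. g s powr q) powr (1 / q)"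
  proof (rule Holder_inequality(2)[OF p pq(1,2) _ _ _ _ f_int g_int])
    show "0 \<le> f s" "0 \<le> g s" for s by (simp_all add: f_def g_def)
  qed measurable
  \<comment> \<open>Replacing \<open>t\<close> by \<open>b\<close> in both factors makes the bound
    uniform in \<open>t\<close>.\<close>
  also have "\<dots> \<le> ?N powr (1 / p) * (ln (b / a) powr \<kappa> / \<kappa>) powr (1 / q)"
    unfolding g_eq
    by (intro mult_mono powr_mono2 f_le divide_right_mono) (use p pq \<kappa> la in auto)
  also have "(ln (b / a) powr \<kappa> / \<kappa>) powr (1 / q) = ln (b / a) powr (\<alpha> - 1 / p) / \<kappa> powr ((p - 1) / p)"
    using \<kappa> pq la by (simp add: powr_divide powr_powr)
  finally have "norm (u t) \<le>
      ?N powr (1 / p) * (ln (b / a) powr (\<alpha> - 1 / p) / \<kappa> powr ((p - 1) / p)) / Gamma \<alpha>"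
    using G by (simp only: pos_le_divide_eq mult.commute)
  then show ?thesis
    by (simp add: weighted_Lp_norm_def \<kappa>_def mult_ac)
qed

theorem theorem5p6:
  fixes a b p \<alpha> :: real
    and u :: "real \<Rightarrow> 'a::{real_normed_field, euclidean_space}"
  assumes "0 < a" and "a < b"
    and "1 < p"
    and "1 / p < \<alpha>" and "\<alpha> \<le> 1"
    and "absolutely_continuous_on_Icc a b u"
    and "u a = 0"
    and "in_weighted_Lp p (\<lambda>x. 1 / x) a b (hadamard_deriv \<alpha> a u)"
  shows "Lp_norm p a b (\<lambda>x. u x / of_real x)
    \<le> inverse a * (b - a) powr (1 / p) * \<bar>ln (b / a)\<bar> powr (\<alpha> - 1 / p)
        / ((\<alpha> * p / (p - 1) - 1 / (p - 1)) powr ((p - 1) / p) * Gamma \<alpha>)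
      * weighted_Lp_norm p (\<lambda>x. 1 / x) a b (hadamard_deriv \<alpha> a u)"
proof -
  define M where "M = ln (b / a) powr (\<alpha> - 1 / p) /
      ((\<alpha> * p / (p - 1) - 1 / (p - 1)) powr ((p - 1) / p) * Gamma \<alpha>)
      * weighted_Lp_norm p (\<lambda>x. 1 / x) a b (hadamard_deriv \<alpha> a u)"
  have u_le: "norm (u x) \<le> M" if "a < x" "x < b" for x
    unfolding M_def using assms that by (intro norm_le_hadamard_norm)
  have "0 \<le> M"
    \<comment> \<open>The midpoint is simply some point where the bound by \<open>M\<close> is
      available.\<close>
    using \<open>a < b\<close> by (intro order_trans[OF norm_ge_zero u_le[of "(a + b) / 2"]]) auto
  have le: "norm (u x / of_real x) powr p \<le> (M / a) powr p" if "a < x" "x < b" for x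
  proof (rule powr_mono2)
    show "norm (u x / of_real x) \<le> M / a"
      using u_le[OF that] that \<open>0 < a\<close> \<open>0 \<le> M\<close> by (simp add: norm_divide frac_le)
  qed (use \<open>1 < p\<close> in auto)
  have "(LINT x:{a<..<b}|lebesgue. norm (u x / of_real x) powr p * 1) \<le> (b - a) * (M / a) powr p"
  \<comment> \<open>Without integrability the integral would be 0 by default and the bound trivial;
    the case split avoids a measurability proof for \<open>u\<close>.\<close>
  proof (cases "set_integrable lebesgue {a<..<b} (\<lambda>x. norm (u x / of_real x) powr p * 1)")
    case True
    have "set_integrable lebesgue {a<..<b} (\<lambda>_. (M / a) powr p)"
      unfolding set_integrable_def using \<open>a < b\<close>
      by (intro integrable_scaleR_left integrable_real_indicator) auto
    then have "(LINT x:{a<..<b}|lebesgue. norm (u x / of_real x) powr p * 1)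
        \<le> (LINT x:{a<..<b}|lebesgue. (M / a) powr p)"
      using le by (intro set_integral_mono True) auto
    also have "\<dots> = (b - a) * (M / a) powr p"
      using \<open>a < b\<close> by (simp add: set_lebesgue_integral_def)
    finally show ?thesis .
  next
    case False
    then show ?thesis
      using \<open>a < b\<close> by (simp add: set_lebesgue_integral_def set_integrable_def not_integrable_integral_eq)
  qed
  moreover have "0 \<le> (LINT x:{a<..<b}|lebesgue. norm (u x / of_real x) powr p * 1)"
    unfolding set_lebesgue_integral_def by (intro integral_nonneg_AE AE_I2) simp
  ultimately have "Lp_norm p a b (\<lambda>x. u x / of_real x) \<le> ((b - a) * (M / a) powr p) powr (1 / p)"
    unfolding weighted_Lp_norm_def using \<open>1 < p\<close> by (intro powr_mono2) auto
  also have "\<dots> = (b - a) powr (1 / p) * (M / a)"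
    using \<open>0 \<le> M\<close> \<open>0 < a\<close> \<open>a < b\<close> \<open>1 < p\<close> by (simp add: powr_mult powr_powr)
  also have "\<dots> = inverse a * (b - a) powr (1 / p) * \<bar>ln (b / a)\<bar> powr (\<alpha> - 1 / p)
        / ((\<alpha> * p / (p - 1) - 1 / (p - 1)) powr ((p - 1) / p) * Gamma \<alpha>)
      * weighted_Lp_norm p (\<lambda>x. 1 / x) a b (hadamard_deriv \<alpha> a u)"
  proof -
    have "0 < ln (b / a)" using assms(1,2) by simp
    then show ?thesis by (simp add: M_def divide_inverse mult.assoc mult.left_commute)
  qed
  finally show ?thesis .
qed

end
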